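(* Let $n,d\in\mathbb{N}$ and $N=\binom{n+d}{d}-1$. Let $\mathcal{A}^n_{\mathbf q}$ be the quantum space defined by a multiplicatively anti-symmetric $(n+1)\times(n+1)$ complex matrix $\mathbf q$, let $w_0<w_1<\dots<w_N$ be the ordered monomials of length $d$ in $x_0,\dots,x_n$, and let $\mathcal{A}^N_{\mathbf g}$ be the quantum space on generators $y_0,\dots,y_N$ whose multiplicatively anti-symmetric $(N+1)\times(N+1)$ matrix $\mathbf g=\|g_{ij}\|$ is given by $g_{ji}=\varphi_{ji}/\varphi_{ij}$ for $0\le i<j\le N$ (with $\varphi$ as in the context). Let $$v_{n,d}:\mathcal{A}^N_{\mathbf g}\to\mathcal{A}^n_{\mathbf q}$$ be the Veronese map, i.e. the algebra homomorphism extending the assignment $y_i\mapsto w_i$, $0\le i\le N$. (1) The image of $v_{n,d}$ is the $d$-Veronese subalgebra $(\mathcal{A}^n_{\mathbf q})^{(d)}=\bigoplus_{k\ge0}(\mathcal{A}^n_{\mathbf q})_{kd}$ of $\mathcal{A}^n_{\mathbf q}$. (2) The kernel $\mathfrak K:=\ker(v_{n,d})$ has a reduced Gröbner basis consisting of exactly $\binom{N+2}{2}-\binom{n+2d}{n}$ binomials: $$\mathcal{R}^{\mathrm v}_{\mathbf q}:=\{\,y_iy_j-\varphi_{ij}\,y_{i'}y_{j'}\ \mid\ (i,j)\in \mathrm{MV}(n,d),\ (i',j')\in \mathrm{C}(n,2,d),\ \varphi_{ij}\in\mathbb{C}^\times\},$$ where for each $(i,j)\in\mathrm{MV}(n,d)$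 the pair $(i',j')\in \mathrm{C}(n,2,d)$ and the scalar $\varphi_{ij}$ are the ones determined by $\mathrm{Nor}(w_iw_j)=\varphi_{ij}w_{i'}w_{j'}$ (so $\mathrm{Nor}(v_{n,d}(y_iy_j))=\varphi_{ij}v_{n,d}(y_{i'}y_{j'})$), and $y_iy_j\succ y_{i'}y_{j'}$.
   Context: A square complex matrix $\mathbf q=\|q_{ij}\|$ is multiplicatively anti-symmetric if all $q_{ij}\in\mathbb{C}^\times$, $q_{ji}=q_{ij}^{-1}$ and $q_{ii}=1$. For such an $(n+1)\times(n+1)$ matrix (indices $0,\dots,n$), the quantum space is $\mathcal{A}^n_{\mathbf q}=\mathbb{C}\langle x_0,\dots,x_n\rangle/(x_jx_i-q_{ji}x_ix_j\mid 0\le i<j\le n)$, graded by length. An ordered monomial is a word $x_0^{\alpha_0}\cdots x_n^{\alpha_n}$; $(\mathcal{T}^n)_p$ is the set of ordered monomials of length $p$. The ordered monomials form a $\mathbb{C}$-basis of $\mathcal{A}^n_{\mathbf q}$; $\mathrm{Nor}(f)$ denotes the unique linear combination of ordered monomials equal to $f$ in $\mathcal{A}^n_{\mathbf q}$. For a word $u$ of multi-degree $\alpha$, $\mathrm{Nor}(u)=\zeta_uT_\alpha$ with $\zeta_u\in\mathbb{C}^\times$ and $T_\alpha=x_0^{\alpha_0}\cdots x_n^{\alpha_n}$. Enumerate $(\mathcal{T}^n)_d=\{w_0=x_0^d<w_1=x_0^{d-1}x_1<\dots<w_N=x_n^d\}$ lexicographically (with $x_0<\dots<x_n$). For $0\le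 j\le N$, let $m(j)$ and $M(j)$ be the smallest and largest index $s$ such that $x_s$ occurs in $w_j$. Set $\mathrm{P}(n,d)=\{(i,j)\mid 0\le i\le j\le N\}$, $\mathrm{C}(n,2,d)=\{(i,j)\in\mathrm{P}(n,d)\mid M(i)\le m(j)\}$ (equivalently the word $w_iw_j$ is ordered), $\mathrm{MV}(n,d)=\{(i,j)\in \mathrm{P}(n,d)\mid M(i)>m(j)\}$. Every element of $(\mathcal{T}^n)_{2d}$ is $w_{i'}w_{j'}$ for a unique $(i',j')\in\mathrm{C}(n,2,d)$. For all $0\le a,b\le N$, $\varphi_{ab}\in\mathbb{C}^\times$ is defined by $\mathrm{Nor}(w_aw_b)=\varphi_{ab}T_\beta$, $\beta$ the multi-degree of $w_aw_b$; in particular $\varphi_{ab}=1$ if $(a,b)\in\mathrm{C}(n,2,d)$. Likewise $\mathcal{A}^N_{\mathbf g}=\mathbb{C}\langle y_0,\dots,y_N\rangle/(y_jy_i-g_{ji}y_iy_j\mid 0\le i<j\le N)$, which is identified as a vector space with the span $\mathbb{C}\mathcal{T}(Y_N)$ of the ordered monomials $\mathcal{T}(Y_N)=\{y_0^{k_0}\cdots y_N^{k_N}\}$. The order $\prec$ is degree-lexicographic on words with $y_0\prec\dots\prec y_N$, restricted to $\mathcal{T}(Y_N)$; $\mathbf{LM}(f)$ is the leading monomial of a nonzero $f\in\mathbb{C}\mathcal{T}(Y_N)$. For $u,v\in\mathcal{T}(Y_N)$, $u\star v$ is the ordered monomial whose exponent vector is the sum of those of $u$ and $v$. A set $F\subset\mathfrak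 K$ of monic elements is a Gröbner basis of a two-sided ideal $\mathfrak K$ of $\mathcal{A}^N_{\mathbf g}$ if for every nonzero $h\in\mathfrak K$ there are $f\in F$ and $u\in\mathcal{T}(Y_N)$ with $\mathbf{LM}(h)=u\star\mathbf{LM}(f)$. It is minimal if no $F\setminus\{f\}$ ($f\in F$) is a Gröbner basis of $\mathfrak K$, and reduced if it is minimal and each $f\in F$ is a linear combination of ordered monomials that are normal modulo $F\setminus\{f\}$, i.e. not of the form $u\star\mathbf{LM}(g)$ with $g\in F\setminus\{f\}$. *)

theory Defs
  imports "HOL-Algebra.QuotRing" "HOL-Library.Poly_Mapping" Complex_Main
begin

text \<open>
  A word in the letters \<open>x\<^sub>0, x\<^sub>1, \<dots>\<close> is the list of its indices. Lists form a monoid under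
  concatenation, so the type \<open>nat list \<Rightarrow>\<^sub>0 complex\<close> carries the (convolution) product of the free
  associative algebra.
\<close>

instantiation list :: (type) monoid_add
begin
definition zero_list :: "'a list" where "zero_list = []"
definition plus_list :: "'a list \<Rightarrow> 'a list \<Rightarrow> 'a list" where "plus_list u v = u @ v"
instance by standard (simp_all add: zero_list_def plus_list_def)
end

type_synonym ncpoly = "nat list \<Rightarrow>\<^sub>0 complex"

definition free_algebra :: "nat \<Rightarrow> ncpoly ring" where
  "free_algebra n =
     \<lparr>carrier = {f. \<forall>u\<in>Poly_Mapping.keys f. set u \<subseteq> {0..n}},
      monoid.mult = (*), one = 1, ring.zero = 0, ring.add = (+)\<rparr>"

abbreviation word :: "nat list \<Rightarrow> ncpoly" where
  "word u \<equiv> Poly_Mapping.single u 1"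

text \<open>\<open>mult_antisym k q\<close>: the \<open>k \<times> k\<close> matrix \<open>q\<close>, indexed from \<open>0\<close>, is multiplicatively anti-symmetric.
  Entries outside the range are irrelevant.\<close>

definition mult_antisym :: "nat \<Rightarrow> (nat \<Rightarrow> nat \<Rightarrow> complex) \<Rightarrow> bool" where
  "mult_antisym k q \<longleftrightarrow>
     (\<forall>i<k. \<forall>j<k. q i j \<noteq> 0 \<and> q j i = inverse (q i j)) \<and> (\<forall>i<k. q i i = 1)"


section \<open>Quantum spaces\<close>

definition quantum_relations :: "nat \<Rightarrow> (nat \<Rightarrow> nat \<Rightarrow> complex) \<Rightarrow> ncpoly set" where
  "quantum_relations n q =
     {word [j, i] - Poly_Mapping.single [i, j] (q j i) | i j. i < j \<and> j \<le> n}"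

definition quantum_ideal :: "nat \<Rightarrow> (nat \<Rightarrow> nat \<Rightarrow> complex) \<Rightarrow> ncpoly set" where
  "quantum_ideal n q = Idl\<^bsub>free_algebra n\<^esub> (quantum_relations n q)"

definition quantum_space :: "nat \<Rightarrow> (nat \<Rightarrow> nat \<Rightarrow> complex) \<Rightarrow> ncpoly set ring" where
  "quantum_space n q = free_algebra n Quot quantum_ideal n q"

definition cls :: "nat \<Rightarrow> (nat \<Rightarrow> nat \<Rightarrow> complex) \<Rightarrow> ncpoly \<Rightarrow> ncpoly set" where
  "cls n q f = quantum_ideal n q +>\<^bsub>free_algebra n\<^esub> f"

text \<open>The factor ring of HOL-Algebra does not record scalar multiplication; it is multiplication by
  the class of a constant.\<close>

definition scal :: "nat \<Rightarrow> (nat \<Rightarrow> nat \<Rightarrow> complex) \<Rightarrow> complex \<Rightarrow> ncpoly set \<Rightarrow> ncpoly set" where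
  "scal n q c X = cls n q (Poly_Mapping.single [] c) \<otimes>\<^bsub>quantum_space n q\<^esub> X"

definition algebra_hom ::
  "nat \<Rightarrow> (nat \<Rightarrow> nat \<Rightarrow> complex) \<Rightarrow> nat \<Rightarrow> (nat \<Rightarrow> nat \<Rightarrow> complex) \<Rightarrow> (ncpoly set \<Rightarrow> ncpoly set) set"
where
  "algebra_hom m g n q =
     {v \<in> ring_hom (quantum_space m g) (quantum_space n q).
        \<forall>c. \<forall>X\<in>carrier (quantum_space m g). v (scal m g c X) = scal n q c (v X)}"


section \<open>Ordered monomials and normal forms\<close>

text \<open>The word \<open>T\<^sub>\<alpha> = x\<^sub>0\<^bsup>\<alpha>\<^sub>0\<^esup> \<cdots> x\<^sub>n\<^bsup>\<alpha>\<^sub>n\<^esup>\<close>; the multi-degree of a word \<open>u\<close> is \<open>count_list u\<close>.\<close>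

definition ord_mono :: "nat \<Rightarrow> (nat \<Rightarrow> nat) \<Rightarrow> nat list" where
  "ord_mono n \<alpha> = concat (map (\<lambda>i. replicate (\<alpha> i) i) [0..<Suc n])"

definition ord_monos :: "nat \<Rightarrow> nat list set" where
  "ord_monos n = range (ord_mono n)"

definition ord_monos_len :: "nat \<Rightarrow> nat \<Rightarrow> nat list set" where
  "ord_monos_len n p = {u \<in> ord_monos n. length u = p}"

text \<open>Elements of the quantum space are cosets; the ordered monomials represent a basis, so every
  coset contains exactly one combination of ordered monomials.\<close>

definition Nor :: "nat \<Rightarrow> (nat \<Rightarrow> nat \<Rightarrow> complex) \<Rightarrow> ncpoly set \<Rightarrow> ncpoly" where
  "Nor n q X = (THE p. Poly_Mapping.keys p \<subseteq> ord_monos n \<and> cls n q p = X)"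


section \<open>The monomials \<open>w\<^sub>0 < \<dots> < w\<^sub>N\<close> of length \<open>d\<close>\<close>

definition wlist :: "nat \<Rightarrow> nat \<Rightarrow> nat list list" where
  "wlist n d =
     (THE ws. sorted_wrt (\<lambda>u v. (u, v) \<in> lex less_than) ws \<and> set ws = ord_monos_len n d)"

definition wmono :: "nat \<Rightarrow> nat \<Rightarrow> nat \<Rightarrow> nat list" where
  "wmono n d i = wlist n d ! i"

definition Nver :: "nat \<Rightarrow> nat \<Rightarrow> nat" where
  "Nver n d = ((n + d) choose d) - 1"

text \<open>\<open>P(n,d)\<close>, \<open>C(n,2,d)\<close> and \<open>MV(n,d)\<close>; \<open>Min (set (wmono n d j))\<close> and \<open>Max (set (wmono n d j))\<close> are
  \<open>m(j)\<close> and \<open>M(j)\<close>.\<close>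

definition Pset :: "nat \<Rightarrow> nat \<Rightarrow> (nat \<times> nat) set" where
  "Pset n d = {(i, j). i \<le> j \<and> j \<le> Nver n d}"

definition Cset :: "nat \<Rightarrow> nat \<Rightarrow> (nat \<times> nat) set" where
  "Cset n d = {(i, j) \<in> Pset n d. Max (set (wmono n d i)) \<le> Min (set (wmono n d j))}"

definition MVset :: "nat \<Rightarrow> nat \<Rightarrow> (nat \<times> nat) set" where
  "MVset n d = {(i, j) \<in> Pset n d. Max (set (wmono n d i)) > Min (set (wmono n d j))}"

definition phi :: "nat \<Rightarrow> nat \<Rightarrow> (nat \<Rightarrow> nat \<Rightarrow> complex) \<Rightarrow> nat \<Rightarrow> nat \<Rightarrow> complex" where
  "phi n d q a b =
     (let u = wmono n d a @ wmono n d b in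
      THE c. c \<noteq> 0 \<and> Nor n q (cls n q (word u)) = Poly_Mapping.single (ord_mono n (count_list u)) c)"


section \<open>Veronese maps and Veronese subalgebras\<close>

definition veronese_map ::
  "nat \<Rightarrow> nat \<Rightarrow> (nat \<Rightarrow> nat \<Rightarrow> complex) \<Rightarrow> (nat \<Rightarrow> nat \<Rightarrow> complex) \<Rightarrow> (ncpoly set \<Rightarrow> ncpoly set) \<Rightarrow> bool"
where
  "veronese_map n d q g v \<longleftrightarrow>
     v \<in> algebra_hom (Nver n d) g n q \<and>
     (\<forall>i\<le>Nver n d. v (cls (Nver n d) g (word [i])) = cls n q (word (wmono n d i)))"

definition graded_comp :: "nat \<Rightarrow> (nat \<Rightarrow> nat \<Rightarrow> complex) \<Rightarrow> nat \<Rightarrow> ncpoly set set" where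
  "graded_comp n q p =
     {cls n q f | f. f \<in> carrier (free_algebra n) \<and> (\<forall>u\<in>Poly_Mapping.keys f. length u = p)}"

text \<open>The internal direct sum of the components of degree \<open>k d\<close>, as the set of finite sums.\<close>

definition veronese_subalgebra :: "nat \<Rightarrow> (nat \<Rightarrow> nat \<Rightarrow> complex) \<Rightarrow> nat \<Rightarrow> ncpoly set set" where
  "veronese_subalgebra n q d =
     {finsum (quantum_space n q) a K | a K. finite K \<and> (\<forall>k\<in>K. a k \<in> graded_comp n q (k * d))}"


section \<open>Groebner bases in a quantum space\<close>

definition deglex :: "nat list \<Rightarrow> nat list \<Rightarrow> bool" where
  "deglex u v \<longleftrightarrow> (u, v) \<in> lenlex less_than"

definition LM :: "nat \<Rightarrow> (nat \<Rightarrow> nat \<Rightarrow> complex) \<Rightarrow> ncpoly set \<Rightarrow> nat list" where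
  "LM n q X =
     (THE u. u \<in> Poly_Mapping.keys (Nor n q X) \<and>
        (\<forall>v\<in>Poly_Mapping.keys (Nor n q X). v \<noteq> u \<longrightarrow> deglex v u))"

definition monic :: "nat \<Rightarrow> (nat \<Rightarrow> nat \<Rightarrow> complex) \<Rightarrow> ncpoly set \<Rightarrow> bool" where
  "monic n q X \<longleftrightarrow>
     X \<noteq> \<zero>\<^bsub>quantum_space n q\<^esub> \<and> Poly_Mapping.lookup (Nor n q X) (LM n q X) = 1"

definition star :: "nat \<Rightarrow> nat list \<Rightarrow> nat list \<Rightarrow> nat list" where
  "star n u v = ord_mono n (\<lambda>i. count_list u i + count_list v i)"

definition groebner_basis ::
  "nat \<Rightarrow> (nat \<Rightarrow> nat \<Rightarrow> complex) \<Rightarrow> ncpoly set set \<Rightarrow> ncpoly set set \<Rightarrow> bool"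
where
  "groebner_basis n q K F \<longleftrightarrow>
     F \<subseteq> K \<and> (\<forall>f\<in>F. monic n q f) \<and>
     (\<forall>h\<in>K. h \<noteq> \<zero>\<^bsub>quantum_space n q\<^esub> \<longrightarrow>
        (\<exists>f\<in>F. \<exists>u\<in>ord_monos n. LM n q h = star n u (LM n q f)))"

definition minimal_groebner_basis ::
  "nat \<Rightarrow> (nat \<Rightarrow> nat \<Rightarrow> complex) \<Rightarrow> ncpoly set set \<Rightarrow> ncpoly set set \<Rightarrow> bool"
where
  "minimal_groebner_basis n q K F \<longleftrightarrow>
     groebner_basis n q K F \<and> (\<forall>f\<in>F. \<not> groebner_basis n q K (F - {f}))"

definition normal_mod ::
  "nat \<Rightarrow> (nat \<Rightarrow> nat \<Rightarrow> complex) \<Rightarrow> ncpoly set set \<Rightarrow> nat list \<Rightarrow> bool"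
where
  "normal_mod n q G t \<longleftrightarrow> (\<nexists>g u. g \<in> G \<and> u \<in> ord_monos n \<and> t = star n u (LM n q g))"

definition reduced_groebner_basis ::
  "nat \<Rightarrow> (nat \<Rightarrow> nat \<Rightarrow> complex) \<Rightarrow> ncpoly set set \<Rightarrow> ncpoly set set \<Rightarrow> bool"
where
  "reduced_groebner_basis n q K F \<longleftrightarrow>
     minimal_groebner_basis n q K F \<and>
     (\<forall>f\<in>F. \<forall>t\<in>Poly_Mapping.keys (Nor n q f). normal_mod n q (F - {f}) t)"


section \<open>The binomials in the kernel of the Veronese map\<close>

text \<open>\<open>Nor (w\<^sub>i w\<^sub>j) = \<phi>\<^sub>i\<^sub>j w\<^sub>i\<^sub>' w\<^sub>j\<^sub>'\<close> for \<open>(i, j)\<close> in \<open>MV(n,d)\<close> and \<open>(i', j')\<close> in \<open>C(n,2,d)\<close>.\<close>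

definition rewrites_to ::
  "nat \<Rightarrow> nat \<Rightarrow> (nat \<Rightarrow> nat \<Rightarrow> complex) \<Rightarrow> nat \<times> nat \<Rightarrow> nat \<times> nat \<Rightarrow> bool"
where
  "rewrites_to n d q = (\<lambda>(i, j) (i', j').
     (i, j) \<in> MVset n d \<and> (i', j') \<in> Cset n d \<and> phi n d q i j \<noteq> 0 \<and>
     Nor n q (cls n q (word (wmono n d i @ wmono n d j)))
       = Poly_Mapping.single (wmono n d i' @ wmono n d j') (phi n d q i j))"

definition veronese_relations ::
  "nat \<Rightarrow> nat \<Rightarrow> (nat \<Rightarrow> nat \<Rightarrow> complex) \<Rightarrow> (nat \<Rightarrow> nat \<Rightarrow> complex) \<Rightarrow> ncpoly set set"
where
  "veronese_relations n d q g =
     (let N = Nver n d; A = quantum_space N g; y = (\<lambda>i. cls N g (word [i])) in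
      {y i \<otimes>\<^bsub>A\<^esub> y j \<ominus>\<^bsub>A\<^esub> scal N g (phi n d q i j) (y i' \<otimes>\<^bsub>A\<^esub> y j') | i j i' j'.
         rewrites_to n d q (i, j) (i', j')})"

end

theory Submission
  imports Defs "HOL-Library.Multiset" "HOL-Library.List_Lexorder"
begin

text \<open>
  Sorting a word, with the product \<open>zeta\<close> of the \<open>q\<close>-entries over its inversions as coefficient,
  extends to a linear map \<open>NF\<close> on the free algebra. It satisfies \<open>NF (f g) = NF (NF f \<cdot> NF g)\<close>, so
  its kernel is an ideal; this kernel is the ideal of the quantum relations, which gives the basis of
  ordered monomials and \<open>\<phi>\<^sub>i\<^sub>j\<close> explicitly.

  The Veronese map multiplies monomials by scalars up to the substitution \<open>y\<^sub>i \<mapsto> w\<^sub>i\<close>. Among the words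
  in the \<open>y\<^sub>i\<close> with a given image up to a scalar, the one obtained by cutting the sorted image into blocks
  of length \<open>d\<close> is the smallest. Hence it cannot be the leading monomial of an element of the kernel:
  its coefficient would not be cancelled by any smaller monomial. A leading monomial therefore maps to
  an unsorted word, and so it contains a pair \<open>y\<^sub>i y\<^sub>j\<close> with \<open>(i, j)\<close> in \<open>MV(n,d)\<close>.
\<close>

section \<open>Linear maps that send monomials to multiples of monomials\<close>

lemma poly_mapping_eq_sum_single:
  fixes f :: "'a \<Rightarrow>\<^sub>0 'b::comm_monoid_add"
  shows "f = (\<Sum>u\<in>Poly_Mapping.keys f. Poly_Mapping.single u (Poly_Mapping.lookup f u))"
proof (rule poly_mapping_eqI)
  fix k
  show "Poly_Mapping.lookup f k =
    Poly_Mapping.lookup (\<Sum>u\<in>Poly_Mapping.keys f. Poly_Mapping.single u (Poly_Mapping.lookup f u)) k"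
    by (auto simp: lookup_sum lookup_single when_def sum.delta in_keys_iff)
qed

lemma poly_mapping_add_induct [consumes 1, case_names zero single add]:
  fixes f :: "'a \<Rightarrow>\<^sub>0 'b::comm_monoid_add"
  assumes "Poly_Mapping.keys f \<subseteq> A"
    and zero: "P 0"
    and single: "\<And>u c. u \<in> A \<Longrightarrow> P (Poly_Mapping.single u c)"
    and add: "\<And>f g. Poly_Mapping.keys f \<subseteq> A \<Longrightarrow> Poly_Mapping.keys g \<subseteq> A \<Longrightarrow> P f \<Longrightarrow> P g \<Longrightarrow> P (f + g)"
  shows "P f"
proof -
  have "Poly_Mapping.keys (\<Sum>u\<in>B. Poly_Mapping.single u (Poly_Mapping.lookup f u)) \<subseteq> A \<and>
      P (\<Sum>u\<in>B. Poly_Mapping.single u (Poly_Mapping.lookup f u))"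
    if "finite B" "B \<subseteq> Poly_Mapping.keys f" for B
    using that
  proof (induction B rule: finite_induct)
    case (insert x B)
    have x: "Poly_Mapping.keys (Poly_Mapping.single x (Poly_Mapping.lookup f x)) \<subseteq> A"
      using insert.prems assms(1) by auto
    have "x \<in> A"
      using insert.prems assms(1) by auto
    then show ?case
      using insert.IH insert.prems insert.hyps x add[OF x _ single]
        keys_add[of "Poly_Mapping.single x (Poly_Mapping.lookup f x)"
          "\<Sum>u\<in>B. Poly_Mapping.single u (Poly_Mapping.lookup f u)"] by auto
  qed (simp add: zero)
  from this[of "Poly_Mapping.keys f"] show ?thesis
    by (simp flip: poly_mapping_eq_sum_single)
qed

definition mono_map ::
  "('a \<Rightarrow> 'b) \<Rightarrow> ('a \<Rightarrow> complex) \<Rightarrow> ('a \<Rightarrow>\<^sub>0 complex) \<Rightarrow> ('b \<Rightarrow>\<^sub>0 complex)" where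
  "mono_map h c f =
     (\<Sum>u\<in>Poly_Mapping.keys f. Poly_Mapping.single (h u) (c u * Poly_Mapping.lookup f u))"

lemma mono_map_superset:
  assumes "finite A" "Poly_Mapping.keys f \<subseteq> A"
  shows "mono_map h c f = (\<Sum>u\<in>A. Poly_Mapping.single (h u) (c u * Poly_Mapping.lookup f u))"
  unfolding mono_map_def
  by (rule sum.mono_neutral_left) (use assms in \<open>auto simp: in_keys_iff\<close>)

lemma mono_map_zero [simp]: "mono_map h c 0 = 0"
  by (simp add: mono_map_def)

lemma mono_map_single [simp]:
  "mono_map h c (Poly_Mapping.single u a) = Poly_Mapping.single (h u) (c u * a)"
  by (simp add: mono_map_def)

lemma mono_map_add: "mono_map h c (f + g) = mono_map h c f + mono_map h c g"
proof -
  let ?A = "Poly_Mapping.keys f \<union> Poly_Mapping.keys g"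
  have "mono_map h c (f + g) =
      (\<Sum>u\<in>?A. Poly_Mapping.single (h u) (c u * Poly_Mapping.lookup (f + g) u))"
    by (rule mono_map_superset) (auto dest: subsetD[OF keys_add])
  also have "\<dots> = mono_map h c f + mono_map h c g"
    by (simp add: mono_map_superset[of ?A] lookup_add distrib_left single_add sum.distrib)
  finally show ?thesis .
qed

lemma mono_map_uminus: "mono_map h c (- f) = - mono_map h c f"
  using mono_map_add[of h c f "- f"] by (simp add: eq_neg_iff_add_eq_0 add.commute)

lemma mono_map_diff: "mono_map h c (f - g) = mono_map h c f - mono_map h c g"
  using mono_map_add[of h c f "- g"] by (simp add: mono_map_uminus)

lemma keys_mono_map: "Poly_Mapping.keys (mono_map h c f) \<subseteq> h ` Poly_Mapping.keys f"
  unfolding mono_map_def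
  by (rule order_trans[OF Poly_Mapping.keys_sum]) (auto split: if_splits)

lemma lookup_mono_map:
  "Poly_Mapping.lookup (mono_map h c f) v =
     (\<Sum>u\<in>{u \<in> Poly_Mapping.keys f. h u = v}. c u * Poly_Mapping.lookup f u)"
  by (simp add: mono_map_def lookup_sum lookup_single when_def sum.If_cases Int_def)

lemma map_scale_zero [simp]: "Poly_Mapping.map ((*) (a :: complex)) 0 = 0"
  by (rule poly_mapping_eqI) (simp add: Poly_Mapping.map.rep_eq)

lemma map_scale_add:
  "Poly_Mapping.map ((*) a) (f + g) =
     Poly_Mapping.map ((*) a) f + Poly_Mapping.map ((*) (a :: complex)) g"
  by (rule poly_mapping_eqI) (simp add: Poly_Mapping.map.rep_eq lookup_add when_def flip: distrib_left)

lemma mono_map_scale: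
  "mono_map h c (Poly_Mapping.map ((*) a) f) = Poly_Mapping.map ((*) a) (mono_map h c f)"
  using subset_UNIV
  by (induction f rule: poly_mapping_add_induct) (simp_all add: map_scale_add mono_map_add mult.left_commute)

section \<open>The free algebra and its ideals\<close>

lemma mem_free_algebra:
  "f \<in> carrier (free_algebra n) \<longleftrightarrow> Poly_Mapping.keys f \<subseteq> {u. set u \<subseteq> {0..n}}"
  by (auto simp: free_algebra_def)

lemma free_algebra_simps [simp]:
  "monoid.mult (free_algebra n) = (*)"
  "monoid.one (free_algebra n) = 1"
  "ring.zero (free_algebra n) = 0"
  "ring.add (free_algebra n) = (+)"
  by (simp_all add: free_algebra_def)

lemma keys_mult_words: "Poly_Mapping.keys ((f::ncpoly) * g) \<subseteq>
    {u @ v | u v. u \<in> Poly_Mapping.keys f \<and> v \<in> Poly_Mapping.keys g}"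
  using keys_mult[of f g] by (simp add: plus_list_def)

lemma mult_single_words:
  "Poly_Mapping.single u a * Poly_Mapping.single v b =
     (Poly_Mapping.single (u @ v) (a * b) :: 'a list \<Rightarrow>\<^sub>0 complex)"
  by (simp add: mult_single plus_list_def)

lemma one_eq_single_Nil: "(1 :: 'a list \<Rightarrow>\<^sub>0 complex) = Poly_Mapping.single [] 1"
  by (simp flip: single_one add: zero_list_def)

lemma free_algebra_closed:
  assumes "f \<in> carrier (free_algebra n)" "g \<in> carrier (free_algebra n)"
  shows "f + g \<in> carrier (free_algebra n)" "f - g \<in> carrier (free_algebra n)"
    "- f \<in> carrier (free_algebra n)" "f * g \<in> carrier (free_algebra n)"
proof -
  have f: "set u \<subseteq> {0..n}" if "u \<in> Poly_Mapping.keys f" for u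
    using assms(1) that by (auto simp: mem_free_algebra)
  have g: "set u \<subseteq> {0..n}" if "u \<in> Poly_Mapping.keys g" for u
    using assms(2) that by (auto simp: mem_free_algebra)
  show "f + g \<in> carrier (free_algebra n)"
    unfolding mem_free_algebra by (rule order_trans[OF keys_add]) (use f g in blast)
  show "f - g \<in> carrier (free_algebra n)"
    unfolding mem_free_algebra by (rule order_trans[OF keys_diff]) (use f g in blast)
  show "- f \<in> carrier (free_algebra n)"
    unfolding mem_free_algebra using f by (auto simp: in_keys_iff)
  show "f * g \<in> carrier (free_algebra n)"
    unfolding mem_free_algebra
  proof (rule order_trans[OF keys_mult_words], clarify)
    fix u v x assume "u \<in> Poly_Mapping.keys f" "v \<in> Poly_Mapping.keys g" "x \<in> set (u @ v)"
    then show "x \<in> {0..n}"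
      using f[of u] g[of v] by (auto simp only: set_append)
  qed
qed

lemma free_algebra_consts:
  "0 \<in> carrier (free_algebra n)" "1 \<in> carrier (free_algebra n)"
  by (auto simp: mem_free_algebra one_eq_single_Nil)

lemma single_mem_free_algebra:
  "set u \<subseteq> {0..n} \<Longrightarrow> Poly_Mapping.single u c \<in> carrier (free_algebra n)"
  by (auto simp: mem_free_algebra)

lemma ring_free_algebra: "ring (free_algebra n)"
proof (rule ringI)
  show "abelian_group (free_algebra n)"
  proof (rule abelian_groupI)
    fix f assume "f \<in> carrier (free_algebra n)"
    then show "\<exists>g\<in>carrier (free_algebra n). g \<oplus>\<^bsub>free_algebra n\<^esub> f = \<zero>\<^bsub>free_algebra n\<^esub>"
      by (intro bexI[of _ "- f"]) (simp_all add: free_algebra_closed)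
  qed (simp_all add: free_algebra_closed free_algebra_consts algebra_simps)
  show "Group.monoid (free_algebra n)"
    by (rule Group.monoidI) (simp_all add: free_algebra_closed free_algebra_consts algebra_simps)
qed (simp_all add: algebra_simps)

lemma free_algebra_a_inv:
  assumes "f \<in> carrier (free_algebra n)"
  shows "\<ominus>\<^bsub>free_algebra n\<^esub> f = - f"
proof -
  interpret ring "free_algebra n" by (rule ring_free_algebra)
  show ?thesis
    using minus_equality[of "- f" f] assms free_algebra_closed[OF assms assms] by simp
qed

lemma quantum_relations_subset: "quantum_relations n q \<subseteq> carrier (free_algebra n)"
  by (auto simp: quantum_relations_def intro!: free_algebra_closed single_mem_free_algebra)

lemma ideal_quantum_ideal: "ideal (quantum_ideal n q) (free_algebra n)"
  unfolding quantum_ideal_def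
  by (rule ring.genideal_ideal[OF ring_free_algebra quantum_relations_subset])

lemma quantum_ideal_minimal:
  assumes "ideal I (free_algebra n)" "quantum_relations n q \<subseteq> I"
  shows "quantum_ideal n q \<subseteq> I"
  unfolding quantum_ideal_def by (rule ring.genideal_minimal[OF ring_free_algebra assms])

lemma quantum_ideal_subset: "quantum_ideal n q \<subseteq> carrier (free_algebra n)"
  using ideal.Icarr[OF ideal_quantum_ideal] by blast

lemma quantum_ideal_zero: "0 \<in> quantum_ideal n q"
  using additive_subgroup.zero_closed[OF ideal.axioms(1)[OF ideal_quantum_ideal], of n q] by simp

lemma quantum_ideal_add:
  "f \<in> quantum_ideal n q \<Longrightarrow> h \<in> quantum_ideal n q \<Longrightarrow> f + h \<in> quantum_ideal n q"
  using additive_subgroup.a_closed[OF ideal.axioms(1)[OF ideal_quantum_ideal], of f n q h] by simp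

lemma quantum_ideal_uminus: "f \<in> quantum_ideal n q \<Longrightarrow> - f \<in> quantum_ideal n q"
  using additive_subgroup.a_inv_closed[OF ideal.axioms(1)[OF ideal_quantum_ideal], of f n q]
    free_algebra_a_inv[of f n] subsetD[OF quantum_ideal_subset, of f n q] by simp

lemma quantum_ideal_mult:
  assumes "f \<in> quantum_ideal n q" "h \<in> carrier (free_algebra n)"
  shows "h * f \<in> quantum_ideal n q" "f * h \<in> quantum_ideal n q"
  using ideal.I_l_closed[OF ideal_quantum_ideal assms] ideal.I_r_closed[OF ideal_quantum_ideal assms]
  by simp_all

lemma ideal_free_algebraI:
  assumes "I \<subseteq> carrier (free_algebra n)" "0 \<in> I"
    and "\<And>f g. f \<in> I \<Longrightarrow> g \<in> I \<Longrightarrow> f + g \<in> I"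
    and "\<And>f. f \<in> I \<Longrightarrow> - f \<in> I"
    and "\<And>f h. f \<in> I \<Longrightarrow> h \<in> carrier (free_algebra n) \<Longrightarrow> h * f \<in> I \<and> f * h \<in> I"
  shows "ideal I (free_algebra n)"
proof (rule idealI[OF ring_free_algebra])
  interpret ring "free_algebra n" by (rule ring_free_algebra)
  show "subgroup I (add_monoid (free_algebra n))"
  proof (rule add.subgroupI)
    fix a assume "a \<in> I"
    then show "\<ominus>\<^bsub>free_algebra n\<^esub> a \<in> I"
      using assms free_algebra_a_inv[of a n] by auto
  qed (use assms in auto)
qed (use assms in auto)

section \<open>Quantum spaces as quotients\<close>

lemma ring_quantum_space: "ring (quantum_space n q)"
  unfolding quantum_space_def by (rule ideal.quotient_is_ring[OF ideal_quantum_ideal])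

lemma carrier_quantum_space: "carrier (quantum_space n q) = cls n q ` carrier (free_algebra n)"
  by (auto simp: quantum_space_def FactRing_def A_RCOSETS_def' cls_def)

lemma cls_closed [simp]: "f \<in> carrier (free_algebra n) \<Longrightarrow> cls n q f \<in> carrier (quantum_space n q)"
  by (simp add: carrier_quantum_space)

lemma cls_eq_image: "cls n q f = (\<lambda>h. h + f) ` quantum_ideal n q"
  by (auto simp: cls_def a_r_coset_def')

lemma cls_eq_iff: "cls n q f = cls n q g \<longleftrightarrow> f - g \<in> quantum_ideal n q"
proof
  assume "cls n q f = cls n q g"
  moreover have "f \<in> cls n q f"
    using quantum_ideal_zero[of n q] by (force simp: cls_eq_image)
  ultimately show "f - g \<in> quantum_ideal n q"
    by (auto simp: cls_eq_image)
next
  have sub: "cls n q f \<subseteq> cls n q g" if fg: "f - g \<in> quantum_ideal n q" for f g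
  proof
    fix x assume "x \<in> cls n q f"
    then obtain h where h: "h \<in> quantum_ideal n q" "x = h + f"
      by (auto simp: cls_eq_image)
    have "h + (f - g) \<in> quantum_ideal n q"
      using quantum_ideal_add[OF h(1) fg] .
    moreover have "x = (h + (f - g)) + g"
      by (simp add: h)
    ultimately show "x \<in> cls n q g"
      unfolding cls_eq_image by blast
  qed
  assume fg: "f - g \<in> quantum_ideal n q"
  have "g - f \<in> quantum_ideal n q"
    using quantum_ideal_uminus[OF fg] by simp
  then show "cls n q f = cls n q g"
    using sub fg by blast
qed

lemma cls_mult:
  assumes "f \<in> carrier (free_algebra n)" "g \<in> carrier (free_algebra n)"
  shows "cls n q f \<otimes>\<^bsub>quantum_space n q\<^esub> cls n q g = cls n q (f * g)"
  using ideal.rcoset_mult_add[OF ideal_quantum_ideal assms, of q]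
  by (simp add: quantum_space_def FactRing_def cls_def)

lemma cls_add:
  assumes "f \<in> carrier (free_algebra n)" "g \<in> carrier (free_algebra n)"
  shows "cls n q f \<oplus>\<^bsub>quantum_space n q\<^esub> cls n q g = cls n q (f + g)"
  using ring_hom_add[OF ideal.rcos_ring_hom[OF ideal_quantum_ideal] assms, of q]
  by (simp add: quantum_space_def cls_def)

lemma cls_one: "cls n q 1 = \<one>\<^bsub>quantum_space n q\<^esub>"
  by (simp add: quantum_space_def FactRing_def cls_def)

lemma cls_zero: "cls n q 0 = \<zero>\<^bsub>quantum_space n q\<^esub>"
  by (simp add: quantum_space_def FactRing_def cls_eq_image)

lemma cls_minus:
  assumes "f \<in> carrier (free_algebra n)" "g \<in> carrier (free_algebra n)"
  shows "cls n q f \<ominus>\<^bsub>quantum_space n q\<^esub> cls n q g = cls n q (f - g)"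
proof -
  interpret ring "quantum_space n q" by (rule ring_quantum_space)
  have "cls n q (f - g) \<oplus>\<^bsub>quantum_space n q\<^esub> cls n q g = cls n q f"
    using assms by (simp add: cls_add free_algebra_closed)
  then show ?thesis
    using assms by (simp add: a_minus_def a_assoc r_neg free_algebra_closed flip: \<open>_ = cls n q f\<close>)
qed

lemma map_scale_eq_mult: "Poly_Mapping.map ((*) c) f = Poly_Mapping.single [] c * (f :: ncpoly)"
  using mult_map_scale_conv_mult[of c f] by (simp add: zero_list_def)

lemma map_scale_closed:
  "f \<in> carrier (free_algebra n) \<Longrightarrow> Poly_Mapping.map ((*) c) f \<in> carrier (free_algebra n)"
  by (simp add: map_scale_eq_mult free_algebra_closed single_mem_free_algebra)

lemma scal_cls:
  "f \<in> carrier (free_algebra n) \<Longrightarrow> scal n q c (cls n q f) = cls n q (Poly_Mapping.map ((*) c) f)"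
  by (simp add: scal_def map_scale_eq_mult cls_mult single_mem_free_algebra)

section \<open>Ordered monomials\<close>

lemma ord_mono_Suc: "ord_mono (Suc n) \<alpha> = ord_mono n \<alpha> @ replicate (\<alpha> (Suc n)) (Suc n)"
  by (simp add: ord_mono_def)

lemma ord_mono_props:
  "sorted (ord_mono n \<alpha>) \<and> set (ord_mono n \<alpha>) \<subseteq> {0..n} \<and>
   (\<forall>i. count_list (ord_mono n \<alpha>) i = (if i \<le> n then \<alpha> i else 0))"
proof (induction n)
  case 0
  have "count_list (replicate k (0::nat)) i = (if i = 0 then k else 0)" for k i
    by (induction k) auto
  then show ?case
    by (auto simp: ord_mono_def)
next
  case (Suc n)
  have "count_list (replicate k (Suc n)) i = (if i = Suc n then k else 0)" for k i
    by (induction k) auto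
  then show ?case
    using Suc by (fastforce simp: ord_mono_Suc sorted_append)
qed

lemma length_ord_mono: "length (ord_mono n \<alpha>) = (\<Sum>i\<le>n. \<alpha> i)"
  by (induction n) (simp_all add: ord_mono_Suc, simp add: ord_mono_def)

lemma sort_eq_iff_count_list:
  "sort u = sort v \<longleftrightarrow> (\<forall>i. count_list u i = count_list (v :: nat list) i)"
  by (metis count_mset mset_sort multiset_eqI properties_for_sort sorted_sort)

lemma ord_mono_count_list:
  assumes "set u \<subseteq> {0..n}"
  shows "ord_mono n (count_list u) = sort u"
proof -
  have "sort (ord_mono n (count_list u)) = sort u"
    unfolding sort_eq_iff_count_list using ord_mono_props[of n "count_list u"] assms
    by (auto simp: count_list_0_iff)
  then show ?thesis
    using ord_mono_props[of n "count_list u"] by (simp add: sorted_sort_id)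
qed

lemma ord_monos_eq: "ord_monos n = {u. sorted u \<and> set u \<subseteq> {0..n}}"
proof -
  have "u \<in> range (ord_mono n)" if "sorted u" "set u \<subseteq> {0..n}" for u
    using ord_mono_count_list[OF that(2)] that(1) by (metis rangeI sorted_sort_id)
  then show ?thesis
    using ord_mono_props unfolding ord_monos_def by blast
qed

lemma ord_monos_subset_free_algebra:
  "Poly_Mapping.keys f \<subseteq> ord_monos n \<Longrightarrow> f \<in> carrier (free_algebra n)"
  by (auto simp: mem_free_algebra ord_monos_eq)

lemma star_eq:
  assumes "set u \<subseteq> {0..n}" "set v \<subseteq> {0..n}"
  shows "star n u v = sort (u @ v)"
proof -
  have "(\<lambda>i. count_list u i + count_list v i) = count_list (u @ v)"
    by auto
  then show ?thesis
    using ord_mono_count_list[of "u @ v" n] assms by (simp add: star_def)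
qed

section \<open>Normal forms\<close>

definition cross :: "(nat \<Rightarrow> nat \<Rightarrow> complex) \<Rightarrow> nat list \<Rightarrow> nat list \<Rightarrow> complex" where
  "cross q u v = prod_list (map (\<lambda>x. prod_list (map (\<lambda>y. if y < x then q x y else 1) v)) u)"

fun zeta :: "(nat \<Rightarrow> nat \<Rightarrow> complex) \<Rightarrow> nat list \<Rightarrow> complex" where
  "zeta q [] = 1"
| "zeta q (x # u) = cross q [x] u * zeta q u"

definition NF :: "(nat \<Rightarrow> nat \<Rightarrow> complex) \<Rightarrow> ncpoly \<Rightarrow> ncpoly" where
  "NF q = mono_map sort (zeta q)"

lemma cross_Nil [simp]: "cross q [] v = 1"
  by (simp add: cross_def)

lemma cross_Cons: "cross q (x # u) v = cross q [x] v * cross q u v"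
  by (simp add: cross_def)

lemma cross_append_right: "cross q u (v @ w) = cross q u v * cross q u w"
  by (induction u) (simp_all add: cross_def mult_ac)

lemma cross_mset_cong:
  assumes "mset u = mset u'" "mset v = mset v'"
  shows "cross q u v = cross q u' v'"
proof -
  have "cross q u v =
    prod_mset (image_mset (\<lambda>x. prod_mset (image_mset (\<lambda>y. if y < x then q x y else 1) (mset v))) (mset u))" for u v
    by (simp add: cross_def flip: prod_mset_prod_list mset_map)
  then show ?thesis
    using assms by simp
qed

lemma zeta_append: "zeta q (u @ v) = zeta q u * zeta q v * cross q u v"
proof (induction u)
  case (Cons x u)
  then show ?case
    by (simp add: cross_append_right cross_Cons[of q x u] mult_ac)
qed simp

lemma cross_sorted: "\<forall>x\<in>set u. \<forall>y\<in>set v. x \<le> y \<Longrightarrow> cross q u v = 1"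
proof (induction u)
  case (Cons x u)
  have "map (\<lambda>y. if y < x then q x y else 1) v = map (\<lambda>y. 1) v"
    using Cons.prems by auto
  then have "cross q [x] v = 1"
    unfolding cross_def by (simp add: map_replicate_const)
  then show ?case
    using Cons by (simp add: cross_Cons[of q x u])
qed simp

lemma zeta_sorted: "sorted u \<Longrightarrow> zeta q u = 1"
  by (induction u) (simp_all add: cross_sorted)

lemma cross_nonzero:
  assumes "mult_antisym (n + 1) q" "set u \<subseteq> {0..n}" "set v \<subseteq> {0..n}"
  shows "cross q u v \<noteq> 0"
proof -
  have "q x y \<noteq> 0" if "x \<in> set u" "y \<in> set v" for x y
  proof -
    have "x < n + 1" "y < n + 1" using that subsetD[OF assms(2), of x] subsetD[OF assms(3), of y] by simp_all
    then show ?thesis using assms(1) unfolding mult_antisym_def by blast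
  qed
  then show ?thesis
    by (auto simp: cross_def prod_list_zero_iff)
qed

lemma zeta_nonzero: "mult_antisym (n + 1) q \<Longrightarrow> set u \<subseteq> {0..n} \<Longrightarrow> zeta q u \<noteq> 0"
proof (induction u)
  case (Cons x u)
  then show ?case
    using cross_nonzero[of n q "[x]" u] by simp
qed simp

lemma NF_single: "NF q (Poly_Mapping.single u a) = Poly_Mapping.single (sort u) (zeta q u * a)"
  by (simp add: NF_def)

lemma NF_mult: "NF q (f * g) = NF q (NF q f * NF q g)"
proof -
  have single_mult: "NF q (Poly_Mapping.single u a * g) =
      NF q (NF q (Poly_Mapping.single u a) * NF q g)" for u a
    using subset_UNIV[of "Poly_Mapping.keys g"]
  proof (induction g rule: poly_mapping_add_induct)
    case (single v b)
    have "sort (sort u @ sort v) = sort (u @ v)"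
      by (rule properties_for_sort) simp_all
    moreover have "zeta q (sort u @ sort v) = cross q u v"
      using cross_mset_cong[of "sort u" u "sort v" v q] by (simp add: zeta_append zeta_sorted)
    ultimately show ?case
      by (simp add: NF_single mult_single_words zeta_append mult_ac)
  qed (simp_all add: NF_def mono_map_add distrib_left)
  show ?thesis
    using subset_UNIV[of "Poly_Mapping.keys f"]
  proof (induction f rule: poly_mapping_add_induct)
    case (add f1 f2)
    then show ?case
      by (simp add: NF_def mono_map_add distrib_right)
  next
    case (single u a)
    show ?case by (rule single_mult)
  qed (simp_all add: NF_def)
qed

lemma NF_add: "NF q (f + g) = NF q f + NF q g"
  by (simp add: NF_def mono_map_add)

lemma NF_diff: "NF q (f - g) = NF q f - NF q g"
  by (simp add: NF_def mono_map_diff)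

lemma keys_NF:
  "f \<in> carrier (free_algebra n) \<Longrightarrow> Poly_Mapping.keys (NF q f) \<subseteq> ord_monos n"
  using keys_mono_map[of sort "zeta q" f] unfolding NF_def
  by (fastforce simp: mem_free_algebra ord_monos_eq)

lemma NF_closed:
  "f \<in> carrier (free_algebra n) \<Longrightarrow> NF q f \<in> carrier (free_algebra n)"
  by (rule ord_monos_subset_free_algebra[OF keys_NF])

lemma NF_id:
  assumes "Poly_Mapping.keys f \<subseteq> ord_monos n"
  shows "NF q f = f"
  using assms
proof (induction f rule: poly_mapping_add_induct)
  case (single u c)
  then show ?case by (simp add: NF_single zeta_sorted ord_monos_eq sorted_sort_id)
qed (simp_all add: NF_def mono_map_add)

lemma NF_quantum_ideal:
  assumes "f \<in> quantum_ideal n q"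
  shows "NF q f = 0"
proof -
  let ?I = "{f \<in> carrier (free_algebra n). NF q f = 0}"
  have "quantum_ideal n q \<subseteq> ?I"
  proof (rule quantum_ideal_minimal)
    show "ideal ?I (free_algebra n)"
    proof (rule ideal_free_algebraI)
      fix f h assume *: "f \<in> ?I" "h \<in> carrier (free_algebra n)"
      then show "h * f \<in> ?I \<and> f * h \<in> ?I"
        using NF_mult[of q h f] NF_mult[of q f h] by (simp add: free_algebra_closed NF_def)
    qed (auto simp: free_algebra_closed free_algebra_consts NF_def mono_map_add mono_map_uminus)
    show "quantum_relations n q \<subseteq> ?I"
    proof
      fix r assume r: "r \<in> quantum_relations n q"
      then have "r \<in> carrier (free_algebra n)"
        using quantum_relations_subset by blast
      moreover have "NF q r = 0"
        using r by (auto simp: quantum_relations_def NF_diff NF_single cross_def)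
      ultimately show "r \<in> ?I" by simp
    qed
  qed
  then show ?thesis using assms by auto
qed

lemma cls_cong_mult:
  assumes "f \<in> carrier (free_algebra n)" "f' \<in> carrier (free_algebra n)"
    and "g \<in> carrier (free_algebra n)" "g' \<in> carrier (free_algebra n)"
    and "cls n q f = cls n q f'" "cls n q g = cls n q g'"
  shows "cls n q (f * g) = cls n q (f' * g')"
  using assms by (metis cls_mult)

lemma cls_cong_add:
  assumes "f \<in> carrier (free_algebra n)" "f' \<in> carrier (free_algebra n)"
    and "g \<in> carrier (free_algebra n)" "g' \<in> carrier (free_algebra n)"
    and "cls n q f = cls n q f'" "cls n q g = cls n q g'"
  shows "cls n q (f + g) = cls n q (f' + g')"
  using assms by (metis cls_add)

lemma cls_swap:
  assumes "i < j" "j \<le> n"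
  shows "cls n q (word [j, i]) = cls n q (Poly_Mapping.single [i, j] (q j i))"
  unfolding cls_eq_iff quantum_ideal_def
  by (rule subsetD[OF ring.genideal_self[OF ring_free_algebra quantum_relations_subset]])
    (use assms in \<open>auto simp: quantum_relations_def\<close>)

lemma cls_Cons_insort:
  assumes "sorted s" "set s \<subseteq> {0..n}" "x \<le> n"
  shows "cls n q (Poly_Mapping.single (x # s) c) = cls n q (Poly_Mapping.single (insort x s) (cross q [x] s * c))"
  using assms
proof (induction s arbitrary: c)
  case (Cons y s)
  show ?case
  proof (cases "x \<le> y")
    case True
    then have "cross q [x] (y # s) = 1"
      using Cons.prems by (intro cross_sorted) auto
    then show ?thesis using True by simp
  next
    case False
    have *: "y \<le> n" "set s \<subseteq> {0..n}" "sorted s" "y < x" using Cons.prems False by auto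
    have "cls n q (word [x, y] * Poly_Mapping.single s c)
        = cls n q (Poly_Mapping.single [y, x] (q x y) * Poly_Mapping.single s c)"
      using * Cons.prems(3) by (intro cls_cong_mult cls_swap single_mem_free_algebra refl) auto
    also have "Poly_Mapping.single [y, x] (q x y) * Poly_Mapping.single s c
        = word [y] * Poly_Mapping.single (x # s) (q x y * c)"
      by (simp add: mult_single_words)
    also have "cls n q \<dots> = cls n q (word [y] * Poly_Mapping.single (insort x s) (cross q [x] s * (q x y * c)))"
      using * Cons.prems(3)
      by (intro cls_cong_mult Cons.IH single_mem_free_algebra refl) (auto simp: set_insort_key)
    also have "word [y] * Poly_Mapping.single (insort x s) (cross q [x] s * (q x y * c))
        = Poly_Mapping.single (insort x (y # s)) (cross q [x] (y # s) * c)"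
      using False by (simp add: mult_single_words cross_def mult_ac)
    finally show ?thesis
      by (simp add: mult_single_words)
  qed
qed (simp add: cross_def)

lemma cls_single_NF:
  "set u \<subseteq> {0..n} \<Longrightarrow> cls n q (Poly_Mapping.single u c) = cls n q (NF q (Poly_Mapping.single u c))"
proof (induction u arbitrary: c)
  case (Cons x u)
  have *: "x \<le> n" "set u \<subseteq> {0..n}" using Cons.prems by auto
  have "cls n q (word [x] * Poly_Mapping.single u c)
      = cls n q (word [x] * NF q (Poly_Mapping.single u c))"
    using * by (intro cls_cong_mult Cons.IH single_mem_free_algebra NF_closed refl) auto
  also have "\<dots> = cls n q (Poly_Mapping.single (x # sort u) (zeta q u * c))"
    by (simp add: NF_single mult_single_words)
  also have "\<dots> = cls n q (NF q (Poly_Mapping.single (x # u) c))"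
    using * cross_mset_cong[of "[x]" "[x]" "sort u" u q]
    by (simp add: cls_Cons_insort NF_single mult_ac)
  finally show ?case
    by (simp add: mult_single_words)
qed (simp add: NF_single)

lemma cls_NF:
  assumes "f \<in> carrier (free_algebra n)"
  shows "cls n q (NF q f) = cls n q f"
  using assms unfolding mem_free_algebra
proof (induction f rule: poly_mapping_add_induct)
  case zero
  show ?case by (simp add: NF_def)
next
  case (single u c)
  then show ?case by (simp add: cls_single_NF)
next
  case (add f g)
  then show ?case
    unfolding NF_add by (intro cls_cong_add NF_closed) (auto simp: mem_free_algebra)
qed

lemma cls_eq_iff_NF:
  assumes "f \<in> carrier (free_algebra n)" "g \<in> carrier (free_algebra n)"
  shows "cls n q f = cls n q g \<longleftrightarrow> NF q f = NF q g"
proof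
  assume "cls n q f = cls n q g"
  then have "NF q (f - g) = 0"
    by (simp add: cls_eq_iff NF_quantum_ideal)
  then show "NF q f = NF q g"
    by (simp add: NF_diff)
next
  assume "NF q f = NF q g"
  then show "cls n q f = cls n q g"
    using cls_NF[OF assms(1), of q] cls_NF[OF assms(2), of q] by simp
qed

lemma Nor_cls:
  assumes "f \<in> carrier (free_algebra n)"
  shows "Nor n q (cls n q f) = NF q f"
  unfolding Nor_def
proof (rule the_equality)
  show "Poly_Mapping.keys (NF q f) \<subseteq> ord_monos n \<and> cls n q (NF q f) = cls n q f"
    using assms by (simp add: keys_NF cls_NF)
  fix p assume p: "Poly_Mapping.keys p \<subseteq> ord_monos n \<and> cls n q p = cls n q f"
  then have "NF q p = NF q f"
    using assms cls_eq_iff_NF ord_monos_subset_free_algebra by blast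
  then show "p = NF q f"
    using p NF_id by metis
qed

lemma cls_eq_zero_iff:
  "f \<in> carrier (free_algebra n) \<Longrightarrow> cls n q f = \<zero>\<^bsub>quantum_space n q\<^esub> \<longleftrightarrow> NF q f = 0"
  using cls_eq_iff_NF[of f n 0 q] by (simp add: cls_zero free_algebra_consts NF_def)

section \<open>The monomials of a given length\<close>

lemma card_ord_monos_len: "card (ord_monos_len n p) = (n + p) choose p"
proof -
  let ?L = "{l::nat list. length l = Suc n \<and> sum_list l = p}"
  have "bij_betw (\<lambda>l. ord_mono n (\<lambda>i. l ! i)) ?L (ord_monos_len n p)"
  proof (rule bij_betw_byWitness[where f' = "\<lambda>u. map (count_list u) [0..<Suc n]"])
    show "\<forall>l\<in>?L. map (count_list (ord_mono n ((!) l))) [0..<Suc n] = l"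
      using ord_mono_props by (auto intro!: nth_equalityI simp del: upt_Suc)
    show "\<forall>u\<in>ord_monos_len n p. ord_mono n ((!) (map (count_list u) [0..<Suc n])) = u"
    proof
      fix u assume "u \<in> ord_monos_len n p"
      then have u: "sorted u" "set u \<subseteq> {0..n}"
        by (auto simp: ord_monos_len_def ord_monos_eq)
      have "ord_mono n ((!) (map (count_list u) [0..<Suc n])) = ord_mono n (count_list u)"
        unfolding ord_mono_def by (intro arg_cong[of _ _ concat] map_cong refl) (auto simp del: upt_Suc)
      then show "ord_mono n ((!) (map (count_list u) [0..<Suc n])) = u"
        using u by (simp add: ord_mono_count_list sorted_sort_id)
    qed
    show "(\<lambda>l. ord_mono n ((!) l)) ` ?L \<subseteq> ord_monos_len n p"
      by (auto simp: ord_monos_len_def ord_monos_def length_ord_mono sum_list_sum_nth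
          lessThan_Suc_atMost atLeast0LessThan)
    show "(\<lambda>u. map (count_list u) [0..<Suc n]) ` ord_monos_len n p \<subseteq> ?L"
    proof clarify
      fix u assume u: "u \<in> ord_monos_len n p"
      then have "set u \<subseteq> {..<Suc n}" "length u = p"
        by (auto simp: ord_monos_len_def ord_monos_eq)
      then have "(\<Sum>i<Suc n. count_list u i) = p"
        using sum_count_set[of u "{..<Suc n}"] by simp
      then show "length (map (count_list u) [0..<Suc n]) = Suc n \<and>
          sum_list (map (count_list u) [0..<Suc n]) = p"
        by (simp add: interv_sum_list_conv_sum_set_nat atLeast0LessThan del: upt_Suc sum.lessThan_Suc)
    qed
  qed
  then show ?thesis
    using bij_betw_same_card card_length_sum_list[of "Suc n" p] by (fastforce simp: add.commute)
qed

lemma finite_ord_monos_len: "finite (ord_monos_len n p)"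
  using card_ord_monos_len[of n p] by (intro card_ge_0_finite) simp

lemma lex_less_than_iff:
  "length u = length v \<Longrightarrow> (u, v) \<in> lex less_than \<longleftrightarrow> u < (v :: nat list)"
proof -
  have "less_than = {(u, v). u < v}" by auto
  then show "length u = length v \<Longrightarrow> (u, v) \<in> lex less_than \<longleftrightarrow> u < v"
    by (simp add: lexord_lex list_less_def)
qed

lemma deglex_same_length: "length u = length v \<Longrightarrow> deglex u v \<longleftrightarrow> u < v"
  by (simp add: deglex_def lenlex_conv lex_less_than_iff)

lemma wlist_eq: "wlist n d = sorted_list_of_set (ord_monos_len n d)"
  unfolding wlist_def
proof (rule the_equality)
  let ?ws = "sorted_list_of_set (ord_monos_len n d)"
  have S: "set ?ws = ord_monos_len n d" "sorted_wrt (<) ?ws"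
    by (simp_all add: finite_ord_monos_len)
  have "sorted_wrt (\<lambda>u v. (u, v) \<in> lex less_than) ?ws"
  proof (rule sorted_wrt_mono_rel[OF _ S(2)], unfold S(1))
    fix u v :: "nat list"
    assume "u \<in> ord_monos_len n d" "v \<in> ord_monos_len n d" "u < v"
    then show "(u, v) \<in> lex less_than"
      by (simp add: ord_monos_len_def lex_less_than_iff)
  qed
  then show "sorted_wrt (\<lambda>u v. (u, v) \<in> lex less_than) ?ws \<and> set ?ws = ord_monos_len n d"
    using S by simp
  fix ws assume ws: "sorted_wrt (\<lambda>u v. (u, v) \<in> lex less_than) ws \<and> set ws = ord_monos_len n d"
  have "sorted_wrt (<) ws"
  proof (rule sorted_wrt_mono_rel)
    show "sorted_wrt (\<lambda>u v. (u, v) \<in> lex less_than) ws" using ws by simp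
    fix u v assume "u \<in> set ws" "v \<in> set ws" "(u, v) \<in> lex less_than"
    then show "u < v"
      using ws lex_less_than_iff[of u v] by (auto simp: ord_monos_len_def)
  qed
  then show "ws = ?ws"
    using ws S strict_sorted_equal by metis
qed

lemma length_wlist: "length (wlist n d) = Suc (Nver n d)"
  by (simp add: wlist_eq Nver_def card_ord_monos_len finite_ord_monos_len)

lemma wmono_less: "i < j \<Longrightarrow> j \<le> Nver n d \<Longrightarrow> wmono n d i < wmono n d j"
  using sorted_wrt_nth_less[of "(<)" "wlist n d" i j] length_wlist[of n d]
  by (simp add: wmono_def wlist_eq)

lemma wmono_le_iff:
  "i \<le> Nver n d \<Longrightarrow> j \<le> Nver n d \<Longrightarrow> wmono n d i \<le> wmono n d j \<longleftrightarrow> i \<le> j"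
  using wmono_less[of i j n d] wmono_less[of j i n d] by (cases i j rule: linorder_cases) auto

lemma wmono_image: "wmono n d ` {0..Nver n d} = ord_monos_len n d"
proof -
  have "wmono n d ` {0..Nver n d} = set (wlist n d)"
    by (auto simp: wmono_def length_wlist set_conv_nth less_Suc_eq_le)
  then show ?thesis by (simp add: wlist_eq finite_ord_monos_len)
qed

lemma wmono_props:
  assumes "i \<le> Nver n d"
  shows "sorted (wmono n d i)" "set (wmono n d i) \<subseteq> {0..n}" "length (wmono n d i) = d"
proof -
  have "wmono n d i \<in> ord_monos_len n d"
    using assms wmono_image[of n d] by fastforce
  then show "sorted (wmono n d i)" "set (wmono n d i) \<subseteq> {0..n}" "length (wmono n d i) = d"
    by (auto simp: ord_monos_len_def ord_monos_eq)
qed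

lemma phi_eq:
  assumes "mult_antisym (n + 1) q" "a \<le> Nver n d" "b \<le> Nver n d"
  shows "phi n d q a b = zeta q (wmono n d a @ wmono n d b)"
proof -
  let ?u = "wmono n d a @ wmono n d b"
  have u: "set ?u \<subseteq> {0..n}"
    using wmono_props(2) assms by simp
  have "Nor n q (cls n q (word ?u)) = Poly_Mapping.single (ord_mono n (count_list ?u)) (zeta q ?u)"
    using Nor_cls[OF single_mem_free_algebra[OF u], of q 1] by (simp only: NF_single ord_mono_count_list[OF u] mult_1_right)
  then show ?thesis
    unfolding phi_def Let_def using zeta_nonzero[OF assms(1) u]
    by (intro the_equality) (auto dest: arg_cong[where f = "\<lambda>p. Poly_Mapping.lookup p (ord_mono n (count_list ?u))"])
qed

section \<open>The Veronese map\<close>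

definition wcat :: "nat \<Rightarrow> nat \<Rightarrow> nat list \<Rightarrow> nat list" where
  "wcat n d y = concat (map (wmono n d) y)"

definition theta :: "nat \<Rightarrow> nat \<Rightarrow> ncpoly \<Rightarrow> ncpoly" where
  "theta n d = mono_map (wcat n d) (\<lambda>_. 1)"

lemma wcat_simps [simp]:
  "wcat n d [] = []" "wcat n d (i # y) = wmono n d i @ wcat n d y"
  "wcat n d (x @ y) = wcat n d x @ wcat n d y"
  by (simp_all add: wcat_def)

lemma set_wcat: "set y \<subseteq> {0..Nver n d} \<Longrightarrow> set (wcat n d y) \<subseteq> {0..n}"
  by (induction y) (use wmono_props(2) in auto)

lemma length_wcat: "set y \<subseteq> {0..Nver n d} \<Longrightarrow> length (wcat n d y) = length y * d"
  by (induction y) (simp_all add: wmono_props)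

lemma theta_single: "theta n d (Poly_Mapping.single y c) = Poly_Mapping.single (wcat n d y) c"
  by (simp add: theta_def)

lemma theta_zero: "theta n d 0 = 0"
  by (simp add: theta_def)

lemma theta_one: "theta n d 1 = 1"
  by (simp add: one_eq_single_Nil theta_single)

lemma theta_add: "theta n d (f + g) = theta n d f + theta n d g"
  by (simp add: theta_def mono_map_add)

lemma theta_uminus: "theta n d (- f) = - theta n d f"
  by (simp add: theta_def mono_map_uminus)

lemma theta_diff: "theta n d (f - g) = theta n d f - theta n d g"
  by (simp add: theta_def mono_map_diff)

lemma theta_scale: "theta n d (Poly_Mapping.map ((*) c) f) = Poly_Mapping.map ((*) c) (theta n d f)"
  by (simp add: theta_def mono_map_scale)

lemma theta_mult: "theta n d (f * g) = theta n d f * theta n d g"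
  using subset_UNIV[of "Poly_Mapping.keys f"]
proof (induction f rule: poly_mapping_add_induct)
  case (single u a)
  show ?case
    using subset_UNIV[of "Poly_Mapping.keys g"]
    by (induction g rule: poly_mapping_add_induct)
      (simp_all add: theta_single theta_zero theta_add mult_single_words distrib_left)
qed (simp_all add: theta_zero theta_add distrib_right)

lemma theta_closed:
  "f \<in> carrier (free_algebra (Nver n d)) \<Longrightarrow> theta n d f \<in> carrier (free_algebra n)"
  using keys_mono_map[of "wcat n d" "\<lambda>_. 1" f] set_wcat[of _ n d]
  unfolding theta_def mem_free_algebra by (blast dest: subsetD)

locale veronese =
  fixes n d :: nat and q g :: "nat \<Rightarrow> nat \<Rightarrow> complex"
  assumes d: "d \<ge> 1"
    and q: "mult_antisym (n + 1) q"
    and g: "\<And>i j. i < j \<Longrightarrow> j \<le> Nver n d \<Longrightarrow> g j i = phi n d q j i / phi n d q i j"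
begin

abbreviation "N \<equiv> Nver n d"

lemma theta_quantum_ideal:
  assumes "f \<in> quantum_ideal N g"
  shows "theta n d f \<in> quantum_ideal n q"
proof -
  let ?I = "{f \<in> carrier (free_algebra N). theta n d f \<in> quantum_ideal n q}"
  have "quantum_ideal N g \<subseteq> ?I"
  proof (rule quantum_ideal_minimal)
    show "ideal ?I (free_algebra N)"
      by (rule ideal_free_algebraI)
        (auto simp: free_algebra_closed free_algebra_consts theta_zero theta_add theta_uminus
          theta_mult theta_closed quantum_ideal_zero
          intro: quantum_ideal_add quantum_ideal_uminus quantum_ideal_mult)
    show "quantum_relations N g \<subseteq> ?I"
    proof
      fix r assume r: "r \<in> quantum_relations N g"
      then obtain i j where ij: "i < j" "j \<le> N" "r = word [j, i] - Poly_Mapping.single [i, j] (g j i)"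
        by (auto simp: quantum_relations_def)
      let ?u = "wmono n d j @ wmono n d i" and ?v = "wmono n d i @ wmono n d j"
      have sets: "set ?u \<subseteq> {0..n}" "set ?v \<subseteq> {0..n}"
        using wmono_props(2) ij by simp_all
      have "sort ?u = sort ?v"
        by (simp add: sort_eq_iff_count_list)
      moreover have "zeta q ?u = zeta q ?v * g j i"
        using ij phi_eq[OF q] g[OF ij(1,2)] zeta_nonzero[OF q sets(2)] by simp
      ultimately have "NF q (word ?u) = NF q (Poly_Mapping.single ?v (g j i))"
        by (simp add: NF_single)
      then have "cls n q (word ?u) = cls n q (Poly_Mapping.single ?v (g j i))"
        using sets by (simp add: cls_eq_iff_NF single_mem_free_algebra)
      then have "theta n d r \<in> quantum_ideal n q"
        by (simp add: cls_eq_iff ij theta_diff theta_single)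
      then show "r \<in> ?I"
        using r quantum_relations_subset by auto
    qed
  qed
  then show ?thesis using assms by auto
qed

lemma theta_cong: "cls N g f = cls N g f' \<Longrightarrow> cls n q (theta n d f) = cls n q (theta n d f')"
  using theta_quantum_ideal by (auto simp: cls_eq_iff simp flip: theta_diff)

lemma ex_veronese_map: "\<exists>v. veronese_map n d q g v"
proof -
  define v where "v X = cls n q (theta n d (Nor N g X))" for X
  have v: "v (cls N g f) = cls n q (theta n d f)" if "f \<in> carrier (free_algebra N)" for f
    unfolding v_def using that by (intro theta_cong) (simp add: Nor_cls cls_NF)
  have "v \<in> ring_hom (quantum_space N g) (quantum_space n q)"
    by (rule ring_hom_memI)
      (auto simp: carrier_quantum_space v cls_mult cls_add theta_mult theta_add theta_closed
        free_algebra_closed free_algebra_consts theta_one simp flip: cls_one)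
  moreover have "v (scal N g c X) = scal n q c (v X)" if "X \<in> carrier (quantum_space N g)" for c X
    using that by (auto simp: carrier_quantum_space scal_cls v theta_closed map_scale_closed theta_scale)
  moreover have "v (cls N g (word [i])) = cls n q (word (wmono n d i))" if "i \<le> N" for i
    using that by (simp add: v theta_single single_mem_free_algebra)
  ultimately have "veronese_map n d q g v"
    by (simp add: veronese_map_def algebra_hom_def)
  then show ?thesis by blast
qed

lemma veronese_map_cls:
  assumes v: "veronese_map n d q g v" and f: "f \<in> carrier (free_algebra N)"
  shows "v (cls N g f) = cls n q (theta n d f)"
proof -
  have hom: "v \<in> ring_hom (quantum_space N g) (quantum_space n q)"
    and sc: "\<And>c X. X \<in> carrier (quantum_space N g) \<Longrightarrow> v (scal N g c X) = scal n q c (v X)"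
    and gen: "\<And>i. i \<le> N \<Longrightarrow> v (cls N g (word [i])) = cls n q (word (wmono n d i))"
    using v by (auto simp: veronese_map_def algebra_hom_def)
  have word: "v (cls N g (word y)) = cls n q (word (wcat n d y))" if "set y \<subseteq> {0..N}" for y
    using that
  proof (induction y)
    case Nil
    then show ?case
      using ring_hom_one[OF hom] by (simp add: cls_one flip: one_eq_single_Nil)
  next
    case (Cons i y)
    have "v (cls N g (word (i # y))) = v (cls N g (word [i]) \<otimes>\<^bsub>quantum_space N g\<^esub> cls N g (word y))"
      using Cons.prems by (simp add: cls_mult single_mem_free_algebra mult_single_words)
    also have "\<dots> = v (cls N g (word [i])) \<otimes>\<^bsub>quantum_space n q\<^esub> v (cls N g (word y))"
      using Cons.prems by (intro ring_hom_mult[OF hom] cls_closed single_mem_free_algebra) auto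
    also have "\<dots> = cls n q (word (wcat n d (i # y)))"
      using Cons wmono_props(2)[of i n d] set_wcat[of y n d]
      by (simp add: single_mem_free_algebra gen cls_mult mult_single_words)
    finally show ?case .
  qed
  show ?thesis
    using f unfolding mem_free_algebra
  proof (induction f rule: poly_mapping_add_induct)
    case zero
    have "v \<zero>\<^bsub>quantum_space N g\<^esub> = \<zero>\<^bsub>quantum_space n q\<^esub>"
      by (rule ring_hom_zero[OF hom ring_quantum_space ring_quantum_space])
    then show ?case by (simp add: cls_zero theta_zero)
  next
    case (single y c)
    then have y: "set y \<subseteq> {0..N}" by simp
    have "v (scal N g c (cls N g (word y))) = scal n q c (cls n q (word (wcat n d y)))"
      using y by (simp add: sc word single_mem_free_algebra)
    then show ?case
      using y set_wcat[OF y] by (simp add: scal_cls single_mem_free_algebra theta_single)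
  next
    case (add f1 f2)
    then have "f1 \<in> carrier (free_algebra N)" "f2 \<in> carrier (free_algebra N)"
      by (simp_all add: mem_free_algebra)
    then show ?case
      using add ring_hom_add[OF hom, of "cls N g f1" "cls N g f2"]
      by (simp add: cls_add theta_add theta_closed)
  qed
qed

end

lemma finsum_cls:
  assumes "finite K" "\<And>k. k \<in> K \<Longrightarrow> h k \<in> carrier (free_algebra n)"
  shows "finsum (quantum_space n q) (\<lambda>k. cls n q (h k)) K = cls n q (sum h K) \<and>
    sum h K \<in> carrier (free_algebra n)"
proof -
  interpret ring "quantum_space n q" by (rule ring_quantum_space)
  show ?thesis
    using assms by (induction K rule: finite_induct)
      (simp_all add: cls_zero free_algebra_consts Pi_def cls_add free_algebra_closed)
qed

lemma veronese_subalgebra_eq: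
  assumes "d \<ge> 1"
  shows "veronese_subalgebra n q d =
    cls n q ` {f \<in> carrier (free_algebra n). \<forall>u\<in>Poly_Mapping.keys f. d dvd length u}"
    (is "_ = cls n q ` ?S")
proof
  interpret ring "quantum_space n q" by (rule ring_quantum_space)
  show "veronese_subalgebra n q d \<subseteq> cls n q ` ?S"
  proof
    fix X assume "X \<in> veronese_subalgebra n q d"
    then obtain a K where K: "finite K" "\<forall>k\<in>K. a k \<in> graded_comp n q (k * d)"
      "X = finsum (quantum_space n q) a K"
      by (auto simp: veronese_subalgebra_def)
    have "\<forall>k\<in>K. \<exists>f. f \<in> carrier (free_algebra n) \<and> (\<forall>u\<in>Poly_Mapping.keys f. length u = k * d) \<and>
        a k = cls n q f"
      using K(2) by (auto simp: graded_comp_def)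
    then obtain h where h: "\<And>k. k \<in> K \<Longrightarrow> h k \<in> carrier (free_algebra n)"
      "\<And>k u. k \<in> K \<Longrightarrow> u \<in> Poly_Mapping.keys (h k) \<Longrightarrow> length u = k * d"
      "\<And>k. k \<in> K \<Longrightarrow> a k = cls n q (h k)"
      by metis
    have "X = finsum (quantum_space n q) (\<lambda>k. cls n q (h k)) K"
      unfolding K(3) by (rule finsum_cong') (auto simp: h)
    then have "X = cls n q (sum h K)" "sum h K \<in> carrier (free_algebra n)"
      using finsum_cls[OF K(1) h(1)] by auto
    moreover have "d dvd length u" if "u \<in> Poly_Mapping.keys (sum h K)" for u
      using subsetD[OF Poly_Mapping.keys_sum that] h(2) by fastforce
    ultimately show "X \<in> cls n q ` ?S" by blast
  qed
  show "cls n q ` ?S \<subseteq> veronese_subalgebra n q d"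
  proof clarify
    fix f assume f: "f \<in> carrier (free_algebra n)" "\<forall>u\<in>Poly_Mapping.keys f. d dvd length u"
    let ?K = "(\<lambda>u. length u div d) ` Poly_Mapping.keys f"
    let ?h = "\<lambda>k. \<Sum>u\<in>{u \<in> Poly_Mapping.keys f. length u div d = k}.
      Poly_Mapping.single u (Poly_Mapping.lookup f u)"
    have keys: "Poly_Mapping.keys (?h k) \<subseteq> {u \<in> Poly_Mapping.keys f. length u div d = k}" for k
      by (rule order_trans[OF Poly_Mapping.keys_sum]) (auto split: if_splits)
    have h: "?h k \<in> carrier (free_algebra n)" for k
      using keys[of k] f(1) unfolding mem_free_algebra by blast
    have "cls n q (?h k) \<in> graded_comp n q (k * d)" for k
      unfolding graded_comp_def using keys[of k] h[of k] f(2) by fastforce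
    moreover have "sum ?h ?K = (\<Sum>u\<in>Poly_Mapping.keys f. Poly_Mapping.single u (Poly_Mapping.lookup f u))"
      by (rule sum.group) auto
    then have "finsum (quantum_space n q) (\<lambda>k. cls n q (?h k)) ?K = cls n q f"
      using finsum_cls[of ?K ?h n q] h by (simp flip: poly_mapping_eq_sum_single)
    ultimately show "cls n q f \<in> veronese_subalgebra n q d"
      unfolding veronese_subalgebra_def by (smt (verit, best) finite_imageI finite_keys mem_Collect_eq)
  qed
qed

lemma sorted_eq_wcat:
  assumes "sorted u" "set u \<subseteq> {0..n}" "length u = k * d"
  shows "\<exists>y. set y \<subseteq> {0..Nver n d} \<and> length y = k \<and> u = wcat n d y"
  using assms
proof (induction k arbitrary: u)
  case (Suc k)
  have "sorted (take d u)" "sorted (drop d u)" "set (take d u) \<subseteq> {0..n}" "set (drop d u) \<subseteq> {0..n}"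
    using Suc.prems set_take_subset[of d u] set_drop_subset[of d u] by (auto simp: sorted_wrt_take sorted_wrt_drop)
  moreover have "length (take d u) = d" "length (drop d u) = k * d"
    using Suc.prems by auto
  ultimately have "take d u \<in> wmono n d ` {0..Nver n d}"
    and "\<exists>y. set y \<subseteq> {0..Nver n d} \<and> length y = k \<and> drop d u = wcat n d y"
    using Suc.IH[of "drop d u"] by (simp_all add: wmono_image ord_monos_len_def ord_monos_eq)
  then obtain y i where "set y \<subseteq> {0..Nver n d}" "length y = k" "drop d u = wcat n d y"
      "i \<le> Nver n d" "take d u = wmono n d i"
    by auto
  then have "set (i # y) \<subseteq> {0..Nver n d}" "length (i # y) = Suc k" "u = wcat n d (i # y)"
    using append_take_drop_id[of d u] by (auto simp del: append_take_drop_id)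
  then show ?case by blast
qed simp

lemma (in veronese) veronese_map_image:
  assumes v: "veronese_map n d q g v"
  shows "v ` carrier (quantum_space N g) = veronese_subalgebra n q d"
  unfolding veronese_subalgebra_eq[OF d] carrier_quantum_space image_image
proof (intro equalityI image_subsetI)
  fix f assume f: "f \<in> carrier (free_algebra N)"
  then have "d dvd length u" if "u \<in> Poly_Mapping.keys (theta n d f)" for u
    using that keys_mono_map[of "wcat n d" "\<lambda>_. 1" f] length_wcat[of _ n d]
    unfolding theta_def mem_free_algebra by fastforce
  then show "v (cls N g f) \<in> cls n q ` {f \<in> carrier (free_algebra n). \<forall>u\<in>Poly_Mapping.keys f. d dvd length u}"
    using f theta_closed by (auto simp: veronese_map_cls[OF v f])
next
  fix f assume f: "f \<in> {f \<in> carrier (free_algebra n). \<forall>u\<in>Poly_Mapping.keys f. d dvd length u}"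
  then have "Poly_Mapping.keys (NF q f) \<subseteq> {u. u \<in> ord_monos n \<and> d dvd length u}"
    using keys_NF[of f n q] keys_mono_map[of sort "zeta q" f] unfolding NF_def by fastforce
  then have "\<exists>h \<in> carrier (free_algebra N). theta n d h = NF q f"
  proof (induction rule: poly_mapping_add_induct)
    case zero
    show ?case by (rule bexI[of _ 0]) (simp_all add: theta_zero free_algebra_consts)
  next
    case (single u c)
    then obtain y where "set y \<subseteq> {0..N}" "u = wcat n d y"
      using sorted_eq_wcat[of u n "length u div d" d] by (auto simp: ord_monos_eq)
    then show ?case
      by (intro bexI[of _ "Poly_Mapping.single y c"]) (simp_all add: theta_single single_mem_free_algebra)
  next
    case (add f1 f2)
    then obtain h1 h2 where "h1 \<in> carrier (free_algebra N)" "theta n d h1 = f1"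
      "h2 \<in> carrier (free_algebra N)" "theta n d h2 = f2" by blast
    then show ?case
      by (intro bexI[of _ "h1 + h2"]) (simp_all add: theta_add free_algebra_closed)
  qed
  then obtain h where h: "h \<in> carrier (free_algebra N)" "theta n d h = NF q f" by blast
  then have "v (cls N g h) = cls n q f"
    using f by (simp add: veronese_map_cls[OF v] cls_NF)
  then show "cls n q f \<in> (\<lambda>x. v (cls N g x)) ` carrier (free_algebra N)"
    using h(1) by (metis imageI)
qed

section \<open>Leading monomials\<close>

lemma deglex_total: "u \<noteq> v \<Longrightarrow> deglex u v \<or> deglex v u"
  using total_lenlex[OF total_less_than] by (auto simp: deglex_def total_on_def)

lemma deglex_trans: "deglex u v \<Longrightarrow> deglex v w \<Longrightarrow> deglex u w"
  unfolding deglex_def by (rule lenlex_trans[OF _ _ trans_less_than])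

lemma deglex_irrefl: "\<not> deglex u u"
  unfolding deglex_def by (rule lenlex_irreflexive) simp

lemma deglex_has_greatest:
  assumes "finite A" "A \<noteq> {}"
  shows "\<exists>u\<in>A. \<forall>v\<in>A. v \<noteq> u \<longrightarrow> deglex v u"
  using assms
proof (induction A rule: finite_ne_induct)
  case (insert x A)
  then obtain u where "u \<in> A" "\<forall>v\<in>A. v \<noteq> u \<longrightarrow> deglex v u" by blast
  then show ?case
    using deglex_total[of x u] deglex_trans by (cases "deglex x u") (metis insert_iff)+
qed simp

lemma LM_cls_eqI:
  assumes "f \<in> carrier (free_algebra n)" "u \<in> Poly_Mapping.keys (NF q f)"
    and "\<And>v. v \<in> Poly_Mapping.keys (NF q f) \<Longrightarrow> v \<noteq> u \<Longrightarrow> deglex v u"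
  shows "LM n q (cls n q f) = u"
  unfolding LM_def Nor_cls[OF assms(1)]
  by (rule the_equality) (use assms deglex_trans deglex_irrefl in metis)+

lemma LM_cls:
  assumes "f \<in> carrier (free_algebra n)" "NF q f \<noteq> 0"
  shows "LM n q (cls n q f) \<in> Poly_Mapping.keys (NF q f)"
    and "\<And>v. v \<in> Poly_Mapping.keys (NF q f) \<Longrightarrow> v \<noteq> LM n q (cls n q f) \<Longrightarrow> deglex v (LM n q (cls n q f))"
proof -
  obtain u where u: "u \<in> Poly_Mapping.keys (NF q f)"
    "\<And>v. v \<in> Poly_Mapping.keys (NF q f) \<Longrightarrow> v \<noteq> u \<Longrightarrow> deglex v u"
    using deglex_has_greatest[of "Poly_Mapping.keys (NF q f)"] assms(2) by auto
  then have "LM n q (cls n q f) = u"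
    by (rule LM_cls_eqI[OF assms(1)])
  then show "LM n q (cls n q f) \<in> Poly_Mapping.keys (NF q f)"
    and "\<And>v. v \<in> Poly_Mapping.keys (NF q f) \<Longrightarrow> v \<noteq> LM n q (cls n q f) \<Longrightarrow> deglex v (LM n q (cls n q f))"
    using u by auto
qed

section \<open>Standard words are minimal in the fibres of the Veronese map\<close>

lemma take_sorted_le:
  fixes s u :: "nat list"
  assumes "sorted s" "mset u \<subseteq># mset s"
  shows "take (length u) s \<le> u"
  using assms
proof (induction s arbitrary: u)
  case (Cons a s)
  show ?case
  proof (cases u)
    case (Cons b u')
    have "b \<in> set (a # s)"
      using Cons.prems(2) mset_subset_eqD[of "mset u" "mset (a # s)" b] Cons by (simp add: \<open>u = b # u'\<close>)
    then have "a \<le> b"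
      using Cons.prems(1) by auto
    moreover have "take (length u') s \<le> u'" if "a = b"
      using Cons.IH[of u'] Cons.prems that by (simp add: \<open>u = b # u'\<close>)
    ultimately show ?thesis
      by (auto simp: \<open>u = b # u'\<close>)
  qed simp
qed simp

lemma sorted_wcat_le:
  assumes "set t \<subseteq> {0..Nver n d}" "set y \<subseteq> {0..Nver n d}" "length t = length y"
    and "sorted (wcat n d t)" "mset (wcat n d y) = mset (wcat n d t)"
  shows "t \<le> y"
  using assms(3,1,2,4,5)
proof (induction t y rule: list_induct2)
  case (Cons a t b y)
  have ab: "a \<le> Nver n d" "b \<le> Nver n d" using Cons.prems by auto
  have "mset (wmono n d b) \<subseteq># mset (wcat n d (b # y))"
    by simp
  then have "mset (wmono n d b) \<subseteq># mset (wcat n d (a # t))"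
    using Cons.prems by (simp only:)
  then have "take (length (wmono n d b)) (wcat n d (a # t)) \<le> wmono n d b"
    using Cons.prems by (intro take_sorted_le)
  then have "wmono n d a \<le> wmono n d b"
    using ab by (simp add: wmono_props)
  then have "a \<le> b"
    using ab by (simp add: wmono_le_iff)
  moreover have "t \<le> y" if "a = b"
    using Cons that by (auto simp: sorted_append)
  ultimately show ?case by auto
qed simp

lemma inj_on_wmono: "inj_on (wmono n d) {0..Nver n d}"
  by (rule inj_onI) (metis atLeastAtMost_iff order_antisym order_refl wmono_le_iff)

context veronese
begin

lemma wmono_nonempty: "i \<le> N \<Longrightarrow> wmono n d i \<noteq> []"
  using wmono_props(3)[of i n d] d by auto

lemma sorted_wmono_append_iff:
  assumes "i \<le> N" "j \<le> N"
  shows "sorted (wmono n d i @ wmono n d j) \<longleftrightarrow> Max (set (wmono n d i)) \<le> Min (set (wmono n d j))"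
  using assms by (auto simp: sorted_append wmono_props wmono_nonempty)

lemma sorted_wmono_append_le:
  assumes "i \<le> N" "j \<le> N" "sorted (wmono n d i @ wmono n d j)"
  shows "i \<le> j"
  using sorted_wcat_le[of "[i, j]" n d "[j, i]"] assms by auto

lemma mem_Cset_iff:
  "(i, j) \<in> Cset n d \<longleftrightarrow> i \<le> N \<and> j \<le> N \<and> sorted (wmono n d i @ wmono n d j)"
  using sorted_wmono_append_iff[of i j] sorted_wmono_append_le[of i j]
  by (auto simp: Cset_def Pset_def)

lemma mem_MVset_iff:
  "(i, j) \<in> MVset n d \<longleftrightarrow> i \<le> j \<and> j \<le> N \<and> \<not> sorted (wmono n d i @ wmono n d j)"
  using sorted_wmono_append_iff[of i j]
  by (auto simp: MVset_def Pset_def)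

lemma card_Cset: "card (Cset n d) = (n + 2 * d) choose n"
proof -
  have "bij_betw (\<lambda>(i, j). wmono n d i @ wmono n d j) (Cset n d) (ord_monos_len n (2 * d))"
  proof (rule bij_betw_imageI)
    show "inj_on (\<lambda>(i, j). wmono n d i @ wmono n d j) (Cset n d)"
      using inj_on_wmono[of n d]
      by (auto simp: inj_on_def mem_Cset_iff wmono_props)
    show "(\<lambda>(i, j). wmono n d i @ wmono n d j) ` Cset n d = ord_monos_len n (2 * d)"
    proof (intro equalityI subsetI)
      fix u assume "u \<in> (\<lambda>(i, j). wmono n d i @ wmono n d j) ` Cset n d"
      then obtain i j where "i \<le> N" "j \<le> N" and u: "sorted u" "u = wmono n d i @ wmono n d j"
        by (auto simp: mem_Cset_iff)
      then have "length u = 2 * d" "set u \<subseteq> {0..n}"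
        using wmono_props(2)[of i n d] wmono_props(2)[of j n d] by (simp_all add: wmono_props)
      then show "u \<in> ord_monos_len n (2 * d)"
        using u(1) by (simp add: ord_monos_len_def ord_monos_eq)
    next
      fix u assume "u \<in> ord_monos_len n (2 * d)"
      then have u: "sorted u" "set u \<subseteq> {0..n}" "length u = 2 * d"
        by (auto simp: ord_monos_len_def ord_monos_eq)
      then obtain y where y: "set y \<subseteq> {0..N}" "length y = 2" "u = wcat n d y"
        using sorted_eq_wcat by blast
      then obtain i j where "y = [i, j]"
        by (auto simp: length_Suc_conv numeral_2_eq_2)
      then show "u \<in> (\<lambda>(i, j). wmono n d i @ wmono n d j) ` Cset n d"
        using y u by (intro image_eqI[of _ _ "(i, j)"]) (auto simp: mem_Cset_iff)
    qed
  qed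
  then have "card (Cset n d) = (n + 2 * d) choose (2 * d)"
    using bij_betw_same_card card_ord_monos_len by metis
  then show ?thesis
    using binomial_symmetric[of n "n + 2 * d"] by simp
qed

end

lemma bij_betw_Pset: "bij_betw (\<lambda>(i, j). [i, j]) (Pset n d) (ord_monos_len (Nver n d) 2)"
  by (rule bij_betwI[where g = "\<lambda>u. (u ! 0, u ! 1)"])
    (auto simp: Pset_def ord_monos_len_def ord_monos_eq length_Suc_conv numeral_2_eq_2)

lemma finite_Pset: "finite (Pset n d)"
  using bij_betw_finite[OF bij_betw_Pset] finite_ord_monos_len by blast

lemma card_Pset: "card (Pset n d) = (Nver n d + 2) choose 2"
  using bij_betw_same_card[OF bij_betw_Pset, of n d] by (simp add: card_ord_monos_len)

lemma finite_MVset: "finite (MVset n d)"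
  by (rule finite_subset[OF _ finite_Pset]) (auto simp: MVset_def)

lemma (in veronese) card_MVset:
  "int (card (MVset n d)) = int ((N + 2) choose 2) - int ((n + 2 * d) choose n)"
proof -
  have "MVset n d \<union> Cset n d = Pset n d" "MVset n d \<inter> Cset n d = {}"
    by (auto simp: MVset_def Cset_def)
  moreover have "finite (Cset n d)"
    by (rule finite_subset[OF _ finite_Pset]) (auto simp: Cset_def)
  ultimately have "card (Pset n d) = card (MVset n d) + card (Cset n d)"
    using card_Un_disjoint[OF finite_MVset] by metis
  then show ?thesis
    by (simp add: card_Pset card_Cset)
qed

section \<open>The binomials\<close>

context veronese
begin

definition binom :: "nat \<times> nat \<Rightarrow> nat \<times> nat \<Rightarrow> ncpoly" where
  "binom = (\<lambda>(i, j) (i', j'). word [i, j] - Poly_Mapping.single [i', j'] (phi n d q i j))"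

lemma Nor_wmono_append:
  assumes "i \<le> N" "j \<le> N"
  shows "Nor n q (cls n q (word (wmono n d i @ wmono n d j))) =
    Poly_Mapping.single (sort (wmono n d i @ wmono n d j)) (phi n d q i j)"
    and "phi n d q i j \<noteq> 0"
proof -
  have "set (wmono n d i @ wmono n d j) \<subseteq> {0..n}"
    using assms wmono_props(2) by simp
  then show "Nor n q (cls n q (word (wmono n d i @ wmono n d j))) =
    Poly_Mapping.single (sort (wmono n d i @ wmono n d j)) (phi n d q i j)"
    "phi n d q i j \<noteq> 0"
    using assms zeta_nonzero[OF q] by (simp_all only: phi_eq[OF q] Nor_cls single_mem_free_algebra NF_single mult_1_right not_False_eq_True)
qed

lemma rewrites_to_iff:
  "rewrites_to n d q (i, j) (i', j') \<longleftrightarrow> (i, j) \<in> MVset n d \<and> (i', j') \<in> Cset n d \<and>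
     sort (wmono n d i @ wmono n d j) = wmono n d i' @ wmono n d j'"
proof (cases "(i, j) \<in> MVset n d")
  case True
  then have ij: "i \<le> N" "j \<le> N" by (auto simp: mem_MVset_iff)
  have "Poly_Mapping.single u (phi n d q i j) = Poly_Mapping.single v (phi n d q i j) \<longleftrightarrow> u = v"
    for u v :: "nat list"
    using Nor_wmono_append(2)[OF ij] by (metis lookup_single_eq lookup_single_not_eq)
  then show ?thesis
    using Nor_wmono_append[OF ij] by (simp add: rewrites_to_def)
qed (simp add: rewrites_to_def)

lemma rewrites_to_ex1:
  assumes "p \<in> MVset n d"
  shows "\<exists>!p'. rewrites_to n d q p p'"
proof -
  obtain i j where p: "p = (i, j)" by fastforce
  then have ij: "i \<le> N" "j \<le> N" using assms by (auto simp: mem_MVset_iff)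
  let ?u = "sort (wmono n d i @ wmono n d j)"
  have "sorted ?u" "set ?u \<subseteq> {0..n}" "length ?u = 2 * d"
    using ij wmono_props(2) by (simp_all add: wmono_props)
  then obtain y where y: "set y \<subseteq> {0..N}" "length y = 2" "?u = wcat n d y"
    using sorted_eq_wcat by blast
  then obtain i' j' where "y = [i', j']"
    by (auto simp: length_Suc_conv numeral_2_eq_2)
  then have ij': "i' \<le> N" "j' \<le> N" "?u = wmono n d i' @ wmono n d j'"
    using y by auto
  have "(i', j') \<in> Cset n d"
    unfolding mem_Cset_iff using ij' by (simp flip: ij'(3))
  then have "rewrites_to n d q p (i', j')"
    unfolding p rewrites_to_iff using assms p ij' by auto
  moreover have "p' = (i', j')" if "rewrites_to n d q p p'" for p'
    using that ij' inj_on_wmono[of n d] unfolding p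
    by (cases p') (auto simp: rewrites_to_iff mem_Cset_iff wmono_props inj_on_def)
  ultimately show ?thesis by blast
qed

lemma rewrites_to_props:
  assumes "rewrites_to n d q (i, j) (i', j')"
  shows "i \<le> j" "j \<le> N" "i' \<le> j'" "j' \<le> N" "[i', j'] < [i, j]" "phi n d q i j \<noteq> 0"
    "phi n d q i' j' = 1"
proof -
  have r: "(i, j) \<in> MVset n d" "(i', j') \<in> Cset n d"
     "sort (wmono n d i @ wmono n d j) = wmono n d i' @ wmono n d j'"
    using assms by (auto simp: rewrites_to_iff)
  show *: "i \<le> j" "j \<le> N" "i' \<le> j'" "j' \<le> N"
    using r sorted_wmono_append_le by (auto simp: mem_MVset_iff mem_Cset_iff)
  have "mset (wcat n d [i, j]) = mset (wcat n d [i', j'])"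
    using arg_cong[OF r(3), of mset] by simp
  then have "[i', j'] \<le> [i, j]"
    using * r(2) by (intro sorted_wcat_le) (auto simp: mem_Cset_iff)
  moreover have "[i', j'] \<noteq> [i, j]"
    using r by (auto simp: mem_MVset_iff mem_Cset_iff)
  ultimately show "[i', j'] < [i, j]"
    by (rule le_neq_trans)
  show "phi n d q i j \<noteq> 0"
    using * by (simp add: Nor_wmono_append)
  show "phi n d q i' j' = 1"
    using * r(2) by (simp add: phi_eq[OF q] mem_Cset_iff zeta_sorted)
qed

lemma binom_props:
  assumes r: "rewrites_to n d q (i, j) (i', j')"
  shows "binom (i, j) (i', j') \<in> carrier (free_algebra N)"
    and "NF g (binom (i, j) (i', j')) = binom (i, j) (i', j')"
    and "Poly_Mapping.keys (binom (i, j) (i', j')) = {[i, j], [i', j']}"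
    and "Poly_Mapping.lookup (binom (i, j) (i', j')) [i, j] = 1"
    and "LM N g (cls N g (binom (i, j) (i', j'))) = [i, j]"
proof -
  note p = rewrites_to_props[OF r]
  let ?b = "binom (i, j) (i', j')"
  show keys: "Poly_Mapping.keys ?b = {[i, j], [i', j']}"
    using p(5,6) by (auto simp: binom_def in_keys_iff lookup_minus lookup_single when_def split: if_splits)
  then have ord: "Poly_Mapping.keys ?b \<subseteq> ord_monos N"
    using p by (auto simp: ord_monos_eq)
  show closed: "?b \<in> carrier (free_algebra N)"
    by (rule ord_monos_subset_free_algebra[OF ord])
  show NF: "NF g ?b = ?b"
    by (rule NF_id[OF ord])
  show "Poly_Mapping.lookup ?b [i, j] = 1"
    using p(5) by (auto simp: binom_def lookup_minus lookup_single when_def)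
  show "LM N g (cls N g ?b) = [i, j]"
    by (rule LM_cls_eqI[OF closed]) (use p(5) in \<open>auto simp: NF keys deglex_same_length\<close>)
qed

lemma veronese_relations_eq:
  "veronese_relations n d q g = {cls N g (binom p p') | p p'. rewrites_to n d q p p'}"
proof -
  have "cls N g (word [i]) \<otimes>\<^bsub>quantum_space N g\<^esub> cls N g (word [j])
      \<ominus>\<^bsub>quantum_space N g\<^esub> scal N g (phi n d q i j) (cls N g (word [i']) \<otimes>\<^bsub>quantum_space N g\<^esub> cls N g (word [j']))
    = cls N g (binom (i, j) (i', j'))" if r: "rewrites_to n d q (i, j) (i', j')" for i j i' j'
    using rewrites_to_props[OF r]
    by (simp add: cls_mult single_mem_free_algebra mult_single_words scal_cls cls_minus binom_def)
  then show ?thesis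
    unfolding veronese_relations_def Let_def by (fastforce)
qed

lemma veronese_relations_inj:
  assumes "rewrites_to n d q p p'" "rewrites_to n d q r r'"
    and "LM N g (cls N g (binom p p')) = LM N g (cls N g (binom r r'))"
  shows "p = r" "p' = r'"
proof -
  show "p = r"
    using assms by (cases p; cases p'; cases r; cases r') (simp add: binom_props)
  moreover have "p \<in> MVset n d"
    using assms(1) by (cases p; cases p') (simp add: rewrites_to_iff)
  ultimately show "p' = r'"
    using assms rewrites_to_ex1 by blast
qed

lemma bij_betw_veronese_relations:
  "bij_betw (\<lambda>p. cls N g (binom p (THE p'. rewrites_to n d q p p'))) (MVset n d) (veronese_relations n d q g)"
proof (rule bij_betw_imageI)
  have *: "rewrites_to n d q p (THE p'. rewrites_to n d q p p')" if "p \<in> MVset n d" for p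
    by (rule theI'[OF rewrites_to_ex1[OF that]])
  show "inj_on (\<lambda>p. cls N g (binom p (THE p'. rewrites_to n d q p p'))) (MVset n d)"
    by (rule inj_onI) (use * veronese_relations_inj(1) in metis)
  show "(\<lambda>p. cls N g (binom p (THE p'. rewrites_to n d q p p'))) ` MVset n d = veronese_relations n d q g"
    unfolding veronese_relations_eq
  proof (intro equalityI subsetI)
    fix X assume "X \<in> {cls N g (binom p p') | p p'. rewrites_to n d q p p'}"
    then obtain p p' where X: "X = cls N g (binom p p')" and r: "rewrites_to n d q p p'"
      by blast
    have p: "p \<in> MVset n d"
      using r by (cases p; cases p') (simp add: rewrites_to_iff)
    have "(THE p'. rewrites_to n d q p p') = p'"
      by (rule the1_equality[OF rewrites_to_ex1[OF p] r])
    then show "X \<in> (\<lambda>p. cls N g (binom p (THE p'. rewrites_to n d q p p'))) ` MVset n d"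
      using X p by (intro image_eqI[of _ _ p]) simp_all
  qed (use * in blast)
qed

section \<open>The kernel of the Veronese map\<close>

lemma NF_theta:
  "NF q (theta n d f) = mono_map (\<lambda>y. sort (wcat n d y)) (\<lambda>y. zeta q (wcat n d y)) f"
  using subset_UNIV
  by (induction f rule: poly_mapping_add_induct)
    (simp_all add: theta_zero theta_single theta_add NF_single NF_add mono_map_add, simp add: NF_def)

lemma binom_in_kernel:
  assumes v: "veronese_map n d q g v" and r: "rewrites_to n d q p p'"
  shows "cls N g (binom p p') \<in> a_kernel (quantum_space N g) (quantum_space n q) v"
proof -
  obtain i j i' j' where p: "p = (i, j)" "p' = (i', j')" by fastforce
  note r = r[unfolded p]
  have "sort (wmono n d i @ wmono n d j) = sort (wmono n d i' @ wmono n d j')"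
    using r by (auto simp: rewrites_to_iff mem_Cset_iff sorted_sort_id)
  moreover have "zeta q (wmono n d i' @ wmono n d j') = 1"
    "zeta q (wmono n d i @ wmono n d j) = phi n d q i j"
    using rewrites_to_props[OF r] by (simp_all flip: phi_eq[OF q])
  ultimately have "NF q (theta n d (binom p p')) = 0"
    unfolding p by (simp add: NF_theta binom_def mono_map_diff)
  then show ?thesis
    using binom_props(1)[OF r] unfolding p
    by (simp add: a_kernel_def' veronese_map_cls[OF v] cls_eq_zero_iff theta_closed)
qed

lemma unsorted_wcat:
  assumes "sorted t" "set t \<subseteq> {0..N}" "\<not> sorted (wcat n d t)"
  shows "\<exists>i j r. (i, j) \<in> MVset n d \<and> mset t = mset (r @ [i, j])"
  using assms
proof (induction t)
  case (Cons a t)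
  show ?case
  proof (cases "sorted (wcat n d t)")
    case True
    then obtain x y where xy: "x \<in> set (wmono n d a)" "y \<in> set (wcat n d t)" "\<not> x \<le> y"
      using Cons.prems by (auto simp: sorted_append wmono_props)
    then obtain b where b: "b \<in> set t" "y \<in> set (wmono n d b)"
      by (auto simp: wcat_def)
    then have "(a, b) \<in> MVset n d"
      using Cons.prems xy by (auto simp: mem_MVset_iff sorted_append)
    moreover have "mset (a # t) = mset (remove1 b t @ [a, b])"
      using b by simp
    ultimately show ?thesis by blast
  next
    case False
    then obtain i j r where "(i, j) \<in> MVset n d" "mset t = mset (r @ [i, j])"
      using Cons by auto
    then have "(i, j) \<in> MVset n d" "mset (a # t) = mset ((a # r) @ [i, j])"
      by auto
    then show ?thesis by blast
  qed
qed simp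

lemma kernel_leading_monomial:
  assumes f: "Poly_Mapping.keys f \<subseteq> ord_monos N" "NF q (theta n d f) = 0"
    and t: "t \<in> Poly_Mapping.keys f" "\<And>y. y \<in> Poly_Mapping.keys f \<Longrightarrow> y \<noteq> t \<Longrightarrow> deglex y t"
  shows "\<not> sorted (wcat n d t)"
proof
  assume sorted: "sorted (wcat n d t)"
  have letters: "set y \<subseteq> {0..N}" if "y \<in> Poly_Mapping.keys f" for y
    using f(1) that by (auto simp: ord_monos_eq)
  have "y = t" if y: "y \<in> Poly_Mapping.keys f" "sort (wcat n d y) = wcat n d t" for y
  proof (rule ccontr)
    assume "y \<noteq> t"
    have "length y * d = length t * d"
      using arg_cong[OF y(2), of length] letters y(1) t(1) by (simp add: length_wcat)
    then have len: "length y = length t" using d by simp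
    have "mset (wcat n d y) = mset (wcat n d t)"
      by (metis mset_sort y(2))
    then have "t \<le> y"
      using letters y(1) t(1) sorted len by (intro sorted_wcat_le) simp_all
    moreover have "y < t"
      using t(2)[OF y(1) \<open>y \<noteq> t\<close>] len by (simp add: deglex_same_length)
    ultimately show False by simp
  qed
  then have "{y \<in> Poly_Mapping.keys f. sort (wcat n d y) = wcat n d t} = {t}"
    using t(1) sorted by (auto simp: sorted_sort_id)
  then have "Poly_Mapping.lookup (NF q (theta n d f)) (wcat n d t) = Poly_Mapping.lookup f t"
    using sorted by (simp add: NF_theta lookup_mono_map zeta_sorted)
  then show False
    using f(2) t(1) by (simp add: in_keys_iff)
qed

lemma groebner_basis_veronese_relations:
  assumes v: "veronese_map n d q g v"
  shows "groebner_basis N g (a_kernel (quantum_space N g) (quantum_space n q) v) (veronese_relations n d q g)"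
  unfolding groebner_basis_def
proof (intro conjI ballI impI)
  show "veronese_relations n d q g \<subseteq> a_kernel (quantum_space N g) (quantum_space n q) v"
    using binom_in_kernel[OF v] by (auto simp: veronese_relations_eq)
next
  fix X assume "X \<in> veronese_relations n d q g"
  then obtain i j i' j' where r: "rewrites_to n d q (i, j) (i', j')" "X = cls N g (binom (i, j) (i', j'))"
    by (auto simp: veronese_relations_eq)
  have "binom (i, j) (i', j') \<noteq> 0"
    using binom_props(4)[OF r(1)] by (metis lookup_zero zero_neq_one)
  then show "monic N g X"
    using binom_props[OF r(1)] by (simp add: monic_def r(2) Nor_cls cls_eq_zero_iff)
next
  fix X assume X: "X \<in> a_kernel (quantum_space N g) (quantum_space n q) v" "X \<noteq> \<zero>\<^bsub>quantum_space N g\<^esub>"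
  then obtain h where h: "h \<in> carrier (free_algebra N)" "X = cls N g h"
    by (auto simp: a_kernel_def' carrier_quantum_space)
  define f where "f = NF g h"
  have f: "Poly_Mapping.keys f \<subseteq> ord_monos N" "f \<in> carrier (free_algebra N)" "X = cls N g f" "NF g f = f"
    using h by (simp_all add: f_def keys_NF NF_closed cls_NF NF_id[OF keys_NF])
  have "NF q (theta n d f) = 0"
    using X f by (simp add: a_kernel_def' veronese_map_cls[OF v] cls_eq_zero_iff theta_closed)
  moreover have "f \<noteq> 0"
    using X(2) f by (auto simp: cls_eq_zero_iff)
  then have LM: "LM N g X \<in> Poly_Mapping.keys f"
      "\<And>y. y \<in> Poly_Mapping.keys f \<Longrightarrow> y \<noteq> LM N g X \<Longrightarrow> deglex y (LM N g X)"
    using LM_cls[OF f(2), of g] f(3,4) by simp_all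
  ultimately have unsorted: "\<not> sorted (wcat n d (LM N g X))"
    using kernel_leading_monomial[OF f(1)] by blast
  have t: "sorted (LM N g X)" "set (LM N g X) \<subseteq> {0..N}"
    using LM(1) f(1) by (auto simp: ord_monos_eq)
  from unsorted_wcat[OF this unsorted] obtain i j r
    where ij: "(i, j) \<in> MVset n d" "mset (LM N g X) = mset (r @ [i, j])"
    by blast
  obtain i' j' where r: "rewrites_to n d q (i, j) (i', j')"
    using rewrites_to_ex1[OF ij(1)] by auto
  have sets: "set (sort r) \<subseteq> {0..N}" "set [i, j] \<subseteq> {0..N}"
    using t(2) arg_cong[OF ij(2), of set_mset] by auto
  have "LM N g X = sort (sort r @ [i, j])"
    using ij(2) t(1) by (metis mset_append mset_sort properties_for_sort)
  then have "LM N g X = star N (sort r) (LM N g (cls N g (binom (i, j) (i', j'))))"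
    using sets by (simp add: star_eq binom_props[OF r])
  moreover have "sort r \<in> ord_monos N"
    using sets by (simp add: ord_monos_eq)
  ultimately show "\<exists>F\<in>veronese_relations n d q g. \<exists>u\<in>ord_monos N. LM N g X = star N u (LM N g F)"
    using r unfolding veronese_relations_eq by blast
qed

lemma star_length_two:
  assumes "i \<le> j" "j \<le> N" "u \<in> ord_monos N" "[a, b] = star N u [i, j]"
  shows "a = i \<and> b = j"
proof -
  have ab: "[a, b] = sort (u @ [i, j])"
    using assms star_eq[of u N "[i, j]"] by (simp add: ord_monos_eq)
  then have "length [a, b] = length u + 2"
    by (simp only: length_sort length_append) simp
  then have "u = []"
    by simp
  then show ?thesis
    using ab assms(1) by simp
qed

lemma reduced_groebner_basis_veronese_relations:
  assumes v: "veronese_map n d q g v"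
  shows "reduced_groebner_basis N g (a_kernel (quantum_space N g) (quantum_space n q) v) (veronese_relations n d q g)"
proof -
  let ?R = "veronese_relations n d q g" and ?K = "a_kernel (quantum_space N g) (quantum_space n q) v"
  have key: "(i, j) \<in> MVset n d \<and> [i, j] \<noteq> LM N g X"
    if prems: "F \<in> ?R - {X}" "u \<in> ord_monos N" "[i, j] = star N u (LM N g F)" "X \<in> ?R" for F X u i j
  proof -
    obtain k l k' l' where r: "rewrites_to n d q (k, l) (k', l')" "F = cls N g (binom (k, l) (k', l'))"
      using prems(1) by (auto simp: veronese_relations_eq)
    have "i = k \<and> j = l"
      using star_length_two[OF rewrites_to_props(1,2)[OF r(1)] prems(2)] prems(3)
      by (simp add: r(2) binom_props(5)[OF r(1)])
    then have "LM N g F = [i, j]" "(i, j) \<in> MVset n d"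
      using r binom_props(5)[OF r(1)] by (auto simp: rewrites_to_iff)
    moreover obtain p p' where X: "rewrites_to n d q p p'" "X = cls N g (binom p p')"
      using prems(4) by (auto simp: veronese_relations_eq)
    have "LM N g F \<noteq> LM N g X"
    proof
      assume "LM N g F = LM N g X"
      then have "F = X"
        using veronese_relations_inj[OF r(1) X(1)] r(2) X(2) by simp
      then show False using prems(1) by simp
    qed
    ultimately show ?thesis by simp
  qed
  have "\<not> groebner_basis N g ?K (?R - {X})" if X: "X \<in> ?R" for X
  proof
    assume G: "groebner_basis N g ?K (?R - {X})"
    have "X \<in> ?K" "monic N g X"
      using groebner_basis_veronese_relations[OF v] X by (auto simp: groebner_basis_def)
    then obtain F u where F: "F \<in> ?R - {X}" "u \<in> ord_monos N" "LM N g X = star N u (LM N g F)"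
      using G unfolding groebner_basis_def monic_def by blast
    obtain i j where ij: "LM N g X = [i, j]"
      using X binom_props(5) by (auto simp: veronese_relations_eq)
    show False
      using key[OF F(1,2) F(3)[unfolded ij] X] ij by simp
  qed
  moreover have "normal_mod N g (?R - {X}) t" if X: "X \<in> ?R" "t \<in> Poly_Mapping.keys (Nor N g X)" for X t
    unfolding normal_mod_def
  proof (rule notI, elim exE conjE)
    fix F u assume F: "F \<in> ?R - {X}" "u \<in> ord_monos N" "t = star N u (LM N g F)"
    obtain i j i' j' where r: "rewrites_to n d q (i, j) (i', j')" "X = cls N g (binom (i, j) (i', j'))"
      using X(1) by (auto simp: veronese_relations_eq)
    have "t \<in> {[i, j], [i', j']}"
      using X(2) binom_props[OF r(1)] by (simp add: r(2) Nor_cls)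
    moreover have "(i', j') \<notin> MVset n d"
      using r(1) by (auto simp: rewrites_to_iff mem_MVset_iff mem_Cset_iff)
    ultimately show False
      using key[OF F(1,2) _ X(1)] F(3) binom_props(5)[OF r(1)] r(2) by fastforce
  qed
  ultimately show ?thesis
    using groebner_basis_veronese_relations[OF v]
    by (simp add: reduced_groebner_basis_def minimal_groebner_basis_def)
qed

lemma Nor_veronese_map_rewrites_to:
  assumes v: "veronese_map n d q g v" and r: "rewrites_to n d q (i, j) (i', j')"
  shows "Nor n q (v (cls N g (word [i, j]))) =
    Poly_Mapping.map ((*) (phi n d q i j)) (Nor n q (v (cls N g (word [i', j']))))"
proof -
  note p = rewrites_to_props[OF r]
  have Nor: "Nor n q (v (cls N g (word [k, l]))) =
      Poly_Mapping.single (sort (wmono n d k @ wmono n d l)) (phi n d q k l)" if "k \<le> N" "l \<le> N" for k l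
    using that by (simp add: veronese_map_cls[OF v] single_mem_free_algebra theta_single Nor_wmono_append)
  have "sort (wmono n d i @ wmono n d j) = sort (wmono n d i' @ wmono n d j')"
    using r by (auto simp: rewrites_to_iff mem_Cset_iff sorted_sort_id)
  then show ?thesis
    using p Nor[of i j] Nor[of i' j'] by simp
qed

end

theorem theorem5p5:
  fixes n d N :: nat and q g :: "nat \<Rightarrow> nat \<Rightarrow> complex"
  assumes "d \<ge> 1"
    and "N = ((n + d) choose d) - 1"
    and "mult_antisym (n + 1) q"
    and "mult_antisym (N + 1) g"
    and "\<And>i j. i < j \<Longrightarrow> j \<le> N \<Longrightarrow> g j i = phi n d q j i / phi n d q i j"
  shows "(\<exists>v. veronese_map n d q g v) \<and>
    (\<forall>v. veronese_map n d q g v \<longrightarrow>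
       v ` carrier (quantum_space N g) = veronese_subalgebra n q d \<and>
       reduced_groebner_basis N g (a_kernel (quantum_space N g) (quantum_space n q) v)
         (veronese_relations n d q g) \<and>
       finite (veronese_relations n d q g) \<and>
       int (card (veronese_relations n d q g))
         = int ((N + 2) choose 2) - int ((n + 2 * d) choose n) \<and>
       (\<forall>i j i' j'. rewrites_to n d q (i, j) (i', j') \<longrightarrow>
          Nor n q (v (cls N g (word [i, j])))
            = Poly_Mapping.map ((*) (phi n d q i j)) (Nor n q (v (cls N g (word [i', j'])))) \<and>
          deglex [i', j'] [i, j]))"
proof -
  have N: "N = Nver n d"
    using assms(2) by (simp add: Nver_def)
  interpret veronese n d q g
    by unfold_locales (use assms N in auto)
  have "finite (veronese_relations n d q g)"
    using bij_betw_finite[OF bij_betw_veronese_relations] finite_MVset by blast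
  moreover have "card (veronese_relations n d q g) = card (MVset n d)"
    using bij_betw_same_card[OF bij_betw_veronese_relations] by simp
  moreover have "deglex [i', j'] [i, j]" if "rewrites_to n d q (i, j) (i', j')" for i j i' j'
    using rewrites_to_props(5)[OF that] by (simp add: deglex_same_length)
  ultimately show ?thesis
    unfolding N
    using ex_veronese_map veronese_map_image reduced_groebner_basis_veronese_relations
      card_MVset Nor_veronese_map_rewrites_to by simp
qed

end
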